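(* Let $\Lambda=\{\lambda_n\}_{n=1}^{\infty}$ be a strictly increasing sequence of positive real numbers such that $\sum_{n=1}^{\infty}\frac{1}{\lambda_n}<\infty$ and $\inf_{n}(\lambda_{n+1}-\lambda_n)>0$. Let $\overline{M_\Lambda}$ be the closed span of $\{t^{\lambda_n}\}_{n=1}^\infty$ in $L^2(0,1)$. Then for any fixed $0<\rho<1$, the operator $T_\rho:\overline{M_\Lambda}\to\overline{M_\Lambda}$ given by $T_\rho(f)(x):=f(\rho x)$ is compact, not normal, and admits Spectral Synthesis.
   Context: $L^2(0,1)$ is the complex Hilbert space with inner product $\langle f,g\rangle=\int_0^1 f(t)\overline{g(t)}\,dt$. Spectral Synthesis: let $T$ be a bounded linear operator on a separable Hilbert space $\mathcal{H}$ which has a set of eigenvectors that is complete in $\mathcal{H}$ (its closed linear span is $\mathcal{H}$). $T$ admits Spectral Synthesis if for every (closed) invariant subspace $A$ of $T$, the set of eigenvectors of $T$ contained in $A$ is complete in $A$ (its closed linear span is $A$). *)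

theory Defs
  imports "HOL-Analysis.Analysis"
begin

section \<open>The complex Hilbert space of square integrable functions on the open unit interval\<close>

abbreviation unit_leb :: "real measure" where
  "unit_leb \<equiv> lebesgue_on {0<..<1}"

definition square_integrable :: "(real \<Rightarrow> complex) \<Rightarrow> bool" where
  "square_integrable f \<longleftrightarrow>
     f \<in> borel_measurable unit_leb \<and> integrable unit_leb (\<lambda>t. (cmod (f t))\<^sup>2)"

lemma square_integrable_zero: "square_integrable (\<lambda>_. 0)"
  by (simp add: square_integrable_def)

lemma square_integrable_cmult:
  assumes "square_integrable f" shows "square_integrable (\<lambda>t. c * f t)"
  using assms by (auto simp: square_integrable_def norm_mult power_mult_distrib)

lemma square_integrable_add:
  assumes "square_integrable f" "square_integrable g"
  shows "square_integrable (\<lambda>t. f t + g t)"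
proof -
  have [measurable]: "f \<in> borel_measurable unit_leb" "g \<in> borel_measurable unit_leb"
    using assms by (auto simp: square_integrable_def)
  have bound: "(cmod (a + b))\<^sup>2 \<le> 2 * (cmod a)\<^sup>2 + 2 * (cmod b)\<^sup>2" for a b :: complex
  proof -
    have "(cmod (a + b))\<^sup>2 \<le> (cmod a + cmod b)\<^sup>2"
      by (intro power_mono norm_triangle_ineq) auto
    also have "\<dots> \<le> 2 * (cmod a)\<^sup>2 + 2 * (cmod b)\<^sup>2"
      using sum_squares_bound[of "cmod a" "cmod b"] by (simp add: power2_sum)
    finally show ?thesis .
  qed
  have "integrable unit_leb (\<lambda>t. (cmod (f t + g t))\<^sup>2)"
    by (rule Bochner_Integration.integrable_bound
          [where f = "\<lambda>t. 2 * (cmod (f t))\<^sup>2 + 2 * (cmod (g t))\<^sup>2"])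
       (use assms bound in \<open>auto simp: square_integrable_def\<close>)
  then show ?thesis by (simp add: square_integrable_def)
qed

lemma integrable_mult_cnj:
  assumes "square_integrable f" "square_integrable g"
  shows "integrable unit_leb (\<lambda>t. f t * cnj (g t))"
proof -
  have [measurable]: "f \<in> borel_measurable unit_leb" "g \<in> borel_measurable unit_leb"
    using assms by (auto simp: square_integrable_def)
  have [measurable]: "(\<lambda>t. cnj (g t)) \<in> borel_measurable unit_leb"
    by (rule borel_measurable_continuous_on[where f = cnj]) (auto intro: continuous_intros)
  have bound: "cmod (a * cnj b) \<le> (cmod a)\<^sup>2 + (cmod b)\<^sup>2" for a b :: complex
  proof -
    have "0 \<le> cmod a * cmod b" by simp
    then have "cmod a * cmod b \<le> (cmod a)\<^sup>2 + (cmod b)\<^sup>2"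
      using sum_squares_bound[of "cmod a" "cmod b"] by linarith
    then show ?thesis by (simp add: norm_mult)
  qed
  show ?thesis
    by (rule Bochner_Integration.integrable_bound
          [where f = "\<lambda>t. (cmod (f t))\<^sup>2 + (cmod (g t))\<^sup>2"])
       (use assms bound in \<open>auto simp: square_integrable_def\<close>)
qed

definition ae_eq :: "(real \<Rightarrow> complex) \<Rightarrow> (real \<Rightarrow> complex) \<Rightarrow> bool" where
  "ae_eq f g \<longleftrightarrow>
     square_integrable f \<and> square_integrable g \<and> (AE t in unit_leb. f t = g t)"

lemma part_equivp_ae_eq: "part_equivp ae_eq"
proof (rule part_equivpI)
  show "\<exists>f. ae_eq f f"
    using square_integrable_zero by (auto simp: ae_eq_def)
  show "symp ae_eq"
    by (rule sympI) (auto simp: ae_eq_def elim: AE_mp)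
  show "transp ae_eq"
    by (rule transpI) (auto simp: ae_eq_def elim: AE_mp)
qed

text \<open>Only the values on \<open>(0,1)\<close> of a representative matter.\<close>

quotient_type L2 = "real \<Rightarrow> complex" / partial: ae_eq
  by (rule part_equivp_ae_eq)

lift_definition L2_of :: "(real \<Rightarrow> complex) \<Rightarrow> L2"
  is "\<lambda>f. if square_integrable f then f else (\<lambda>_. 0)"
  by (auto simp: ae_eq_def square_integrable_zero)

lift_definition scaleC :: "complex \<Rightarrow> L2 \<Rightarrow> L2" (infixr \<open>*\<^sub>C\<close> 75)
  is "\<lambda>c f t. c * f t"
  by (auto simp: ae_eq_def square_integrable_cmult elim: AE_mp)

lift_definition cinner :: "L2 \<Rightarrow> L2 \<Rightarrow> complex"
  is "\<lambda>f g. integral\<^sup>L unit_leb (\<lambda>t. f t * cnj (g t))"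
proof -
  fix f f' g g' assume *: "ae_eq f f'" "ae_eq g g'"
  then have "AE t in unit_leb. f t * cnj (g t) = f' t * cnj (g' t)"
    by (auto simp: ae_eq_def)
  moreover have "integrable unit_leb (\<lambda>t. f t * cnj (g t))" "integrable unit_leb (\<lambda>t. f' t * cnj (g' t))"
    using * by (auto simp: ae_eq_def intro: integrable_mult_cnj)
  ultimately show "integral\<^sup>L unit_leb (\<lambda>t. f t * cnj (g t)) = integral\<^sup>L unit_leb (\<lambda>t. f' t * cnj (g' t))"
    by (intro integral_cong_AE) auto
qed

instantiation L2 :: real_inner
begin

lift_definition zero_L2 :: L2 is "\<lambda>_. 0"
  by (simp add: ae_eq_def square_integrable_zero)

lift_definition plus_L2 :: "L2 \<Rightarrow> L2 \<Rightarrow> L2" is "\<lambda>f g t. f t + g t"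
  by (auto simp: ae_eq_def square_integrable_add elim: AE_mp)

definition uminus_L2 :: "L2 \<Rightarrow> L2" where "uminus_L2 f = (- 1) *\<^sub>C f"
definition minus_L2 :: "L2 \<Rightarrow> L2 \<Rightarrow> L2" where "minus_L2 f g = f + (- g)"
definition scaleR_L2 :: "real \<Rightarrow> L2 \<Rightarrow> L2" where "scaleR_L2 r f = complex_of_real r *\<^sub>C f"
definition inner_L2 :: "L2 \<Rightarrow> L2 \<Rightarrow> real" where "inner_L2 f g = Re (cinner f g)"
definition norm_L2 :: "L2 \<Rightarrow> real" where "norm_L2 f = sqrt (inner f f)"
definition sgn_L2 :: "L2 \<Rightarrow> L2" where "sgn_L2 f = inverse (norm f) *\<^sub>R f"
definition dist_L2 :: "L2 \<Rightarrow> L2 \<Rightarrow> real" where "dist_L2 f g = norm (f - g)"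
definition uniformity_L2 :: "(L2 \<times> L2) filter" where
  "uniformity_L2 = (INF e\<in>{0<..}. principal {(x, y). dist x y < e})"
definition open_L2 :: "L2 set \<Rightarrow> bool" where
  "open_L2 S \<longleftrightarrow> (\<forall>x\<in>S. \<forall>\<^sub>F (x', y) in uniformity. x' = x \<longrightarrow> y \<in> S)"

instance
proof
  fix f g h :: L2 and r s :: real
  show "f + g + h = f + (g + h)"
    by transfer (auto simp: ae_eq_def square_integrable_add add.assoc)
  show "f + g = g + f"
    by transfer (auto simp: ae_eq_def square_integrable_add add.commute)
  show "0 + f = f"
    by transfer (auto simp: ae_eq_def)
  show "- f + f = 0"
    unfolding uminus_L2_def by transfer (auto simp: ae_eq_def square_integrable_zero)
  show "f - g = f + - g" by (simp add: minus_L2_def)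
  show "r *\<^sub>R (f + g) = r *\<^sub>R f + r *\<^sub>R g"
    unfolding scaleR_L2_def
    by transfer (auto simp: ae_eq_def distrib_left intro!: square_integrable_add square_integrable_cmult)
  show "(r + s) *\<^sub>R f = r *\<^sub>R f + s *\<^sub>R f"
    unfolding scaleR_L2_def
    by transfer (auto simp: ae_eq_def distrib_right intro!: square_integrable_add square_integrable_cmult)
  show "r *\<^sub>R s *\<^sub>R f = (r * s) *\<^sub>R f"
    unfolding scaleR_L2_def
    by transfer (auto simp: ae_eq_def mult.assoc intro!: square_integrable_cmult)
  show "1 *\<^sub>R f = f"
    unfolding scaleR_L2_def by transfer (auto simp: ae_eq_def)
  show "sgn f = inverse (norm f) *\<^sub>R f" by (rule sgn_L2_def)
  show "dist f g = norm (f - g)" by (rule dist_L2_def)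
  show "(uniformity :: (L2 \<times> L2) filter) = (INF e\<in>{0<..}. principal {(x, y). dist x y < e})"
    by (rule uniformity_L2_def)
  show "open S \<longleftrightarrow> (\<forall>x\<in>S. \<forall>\<^sub>F (x', y) in uniformity. x' = x \<longrightarrow> y \<in> S)" for S :: "L2 set"
    by (rule open_L2_def)
  show "inner f g = inner g f"
    unfolding inner_L2_def
  proof transfer
    fix f g assume "ae_eq f f" "ae_eq g g"
    then have i: "integrable unit_leb (\<lambda>t. f t * cnj (g t))" "integrable unit_leb (\<lambda>t. g t * cnj (f t))"
      by (auto simp: ae_eq_def intro: integrable_mult_cnj)
    show "Re (\<integral>t. f t * cnj (g t) \<partial>unit_leb) = Re (\<integral>t. g t * cnj (f t) \<partial>unit_leb)"
      unfolding integral_Re[OF i(1), symmetric] integral_Re[OF i(2), symmetric]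
      by (simp add: mult.commute)
  qed
  show "inner (f + g) h = inner f h + inner g h"
    unfolding inner_L2_def
    by transfer (auto simp: ae_eq_def distrib_right Bochner_Integration.integral_add integrable_mult_cnj)
  show "inner (r *\<^sub>R f) g = r * inner f g"
    unfolding inner_L2_def scaleR_L2_def by transfer (simp add: mult.assoc)
  have sq: "Re (\<integral>t. f t * cnj (f t) \<partial>unit_leb) = (\<integral>t. (cmod (f t))\<^sup>2 \<partial>unit_leb)" if "ae_eq f f" for f
  proof -
    have i: "integrable unit_leb (\<lambda>t. f t * cnj (f t))"
      using that by (auto simp: ae_eq_def intro: integrable_mult_cnj)
    show ?thesis
      unfolding integral_Re[OF i, symmetric] by (simp add: complex_mult_cnj cmod_power2)
  qed
  show "0 \<le> inner f f"
    unfolding inner_L2_def by transfer (simp add: sq)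
  show "inner f f = 0 \<longleftrightarrow> f = 0"
    unfolding inner_L2_def
  proof transfer
    fix f assume f: "ae_eq f f"
    then have "integrable unit_leb (\<lambda>t. (cmod (f t))\<^sup>2)"
      by (simp add: ae_eq_def square_integrable_def)
    then have "(\<integral>t. (cmod (f t))\<^sup>2 \<partial>unit_leb) = 0 \<longleftrightarrow> (AE t in unit_leb. (cmod (f t))\<^sup>2 = 0)"
      by (rule integral_nonneg_eq_0_iff_AE) simp
    then show "Re (\<integral>t. f t * cnj (f t) \<partial>unit_leb) = 0 \<longleftrightarrow> ae_eq f (\<lambda>_. 0)"
      using f by (simp add: sq ae_eq_def square_integrable_zero)
  qed
  show "norm f = sqrt (inner f f)" by (rule norm_L2_def)
qed

end

global_interpretation L2: vector_space scaleC
  defines cspan = L2.span and csubspace = L2.subspace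
proof
  fix a b :: complex and f g :: L2
  show "a *\<^sub>C (f + g) = a *\<^sub>C f + a *\<^sub>C g"
    by transfer (auto simp: ae_eq_def distrib_left intro!: square_integrable_add square_integrable_cmult)
  show "(a + b) *\<^sub>C f = a *\<^sub>C f + b *\<^sub>C f"
    by transfer (auto simp: ae_eq_def distrib_right intro!: square_integrable_add square_integrable_cmult)
  show "a *\<^sub>C b *\<^sub>C f = (a * b) *\<^sub>C f"
    by transfer (auto simp: ae_eq_def mult.assoc intro!: square_integrable_cmult)
  show "1 *\<^sub>C f = f"
    by transfer (auto simp: ae_eq_def)
qed


section \<open>Operators on a closed subspace\<close>

text \<open>
  The Hilbert spaces considered are closed complex subspaces \<open>H\<close> of \<^typ>\<open>L2\<close> (all of them separable);
  an operator on \<open>H\<close> is a function on \<^typ>\<open>L2\<close> of which only the values on \<open>H\<close> matter.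
  As \<open>H\<close> is closed, closures taken in \<^typ>\<open>L2\<close> of subsets of \<open>H\<close> agree with closures in \<open>H\<close>.
\<close>

definition bounded_operator_on :: "L2 set \<Rightarrow> (L2 \<Rightarrow> L2) \<Rightarrow> bool" where
  "bounded_operator_on H T \<longleftrightarrow>
     T ` H \<subseteq> H \<and>
     (\<forall>f\<in>H. \<forall>g\<in>H. T (f + g) = T f + T g) \<and>
     (\<forall>c. \<forall>f\<in>H. T (c *\<^sub>C f) = c *\<^sub>C T f) \<and>
     (\<exists>K. \<forall>f\<in>H. norm (T f) \<le> K * norm f)"

definition compact_operator_on :: "L2 set \<Rightarrow> (L2 \<Rightarrow> L2) \<Rightarrow> bool" where
  "compact_operator_on H T \<longleftrightarrow>
     bounded_operator_on H T \<and> compact (closure (T ` (H \<inter> cball 0 1)))"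

definition is_adjoint_on :: "L2 set \<Rightarrow> (L2 \<Rightarrow> L2) \<Rightarrow> (L2 \<Rightarrow> L2) \<Rightarrow> bool" where
  "is_adjoint_on H T S \<longleftrightarrow>
     bounded_operator_on H S \<and> (\<forall>f\<in>H. \<forall>g\<in>H. cinner (T f) g = cinner f (S g))"

text \<open>The adjoint on \<open>H\<close> exists and is unique on \<open>H\<close> for every bounded operator on \<open>H\<close>.\<close>

definition normal_operator_on :: "L2 set \<Rightarrow> (L2 \<Rightarrow> L2) \<Rightarrow> bool" where
  "normal_operator_on H T \<longleftrightarrow>
     bounded_operator_on H T \<and> (\<exists>S. is_adjoint_on H T S \<and> (\<forall>f\<in>H. T (S f) = S (T f)))"

definition eigenvectors_on :: "L2 set \<Rightarrow> (L2 \<Rightarrow> L2) \<Rightarrow> L2 set" where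
  "eigenvectors_on H T = {f \<in> H. f \<noteq> 0 \<and> (\<exists>\<mu>. T f = \<mu> *\<^sub>C f)}"

definition complete_in :: "L2 set \<Rightarrow> L2 set \<Rightarrow> bool" where
  "complete_in E A \<longleftrightarrow> closure (cspan E) = A"

definition invariant_subspace_on :: "L2 set \<Rightarrow> (L2 \<Rightarrow> L2) \<Rightarrow> L2 set \<Rightarrow> bool" where
  "invariant_subspace_on H T A \<longleftrightarrow> csubspace A \<and> closed A \<and> A \<subseteq> H \<and> T ` A \<subseteq> A"

definition admits_spectral_synthesis_on :: "L2 set \<Rightarrow> (L2 \<Rightarrow> L2) \<Rightarrow> bool" where
  "admits_spectral_synthesis_on H T \<longleftrightarrow>
     bounded_operator_on H T \<and>
     (\<exists>E\<subseteq>eigenvectors_on H T. complete_in E H) \<and>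
     (\<forall>A. invariant_subspace_on H T A \<longrightarrow> complete_in (eigenvectors_on H T \<inter> A) A)"


section \<open>Muntz spaces and dilations\<close>

definition muntz_space :: "(nat \<Rightarrow> real) \<Rightarrow> L2 set" where
  "muntz_space lam = closure (cspan (range (\<lambda>n. L2_of (\<lambda>t. complex_of_real (t powr lam n)))))"

lemma measurable_scale: "(*) r \<in> lebesgue \<rightarrow>\<^sub>M (lebesgue :: real measure)"
proof -
  have "(*\<^sub>R) r = ((*) r :: real \<Rightarrow> real)" by (simp add: fun_eq_iff)
  then show ?thesis using lebesgue_measurable_scaling[of r, where 'a = real] by simp
qed

lemma ae_scale:
  assumes r: "0 < r" "r < 1" and ae: "AE t in unit_leb. P t"
  shows "AE t in unit_leb. P (r * t)"
proof -
  let ?Q = "\<lambda>t. t \<in> {0<..<1} \<longrightarrow> P t"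
  have "AE t in density (distr lebesgue lebesgue (\<lambda>x. 0 + r * x)) (\<lambda>_. ennreal \<bar>r\<bar>). ?Q t"
    using ae r by (subst lebesgue_real_affine[symmetric]) (auto simp: AE_restrict_space_iff)
  then have "AE t in distr lebesgue lebesgue (\<lambda>x. 0 + r * x). ?Q t"
    using r by (subst (asm) AE_density) auto
  then have "AE t in lebesgue. ?Q (0 + r * t)"
    by (rule AE_distrD[rotated]) (use measurable_scale[of r] in simp)
  then have "AE t in lebesgue. t \<in> {0<..<1} \<longrightarrow> P (r * t)"
  proof (rule AE_mp, intro AE_I2 impI)
    fix t :: real assume Q: "?Q (0 + r * t)" and t: "t \<in> {0<..<1}"
    have "r * t < 1 * 1" using r t by (intro mult_strict_mono) auto
    then show "P (r * t)" using Q r t by simp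
  qed
  then show ?thesis by (simp add: AE_restrict_space_iff)
qed

lemma square_integrable_scale:
  assumes r: "0 < r" "r < 1" and f: "square_integrable f"
  shows "square_integrable (\<lambda>t. f (r * t))"
proof -
  have sub: "r * t < 1" if "0 < t" "t < 1" for t
    using mult_strict_mono[of r 1 t 1] r that by simp
  have m: "(\<lambda>t. r * t) \<in> unit_leb \<rightarrow>\<^sub>M unit_leb"
    by (rule measurable_restrict_space3)
       (use measurable_scale[of r] r sub in auto)
  have meas: "(\<lambda>t. f (r * t)) \<in> borel_measurable unit_leb"
    using measurable_compose[OF m, of f borel] f by (simp add: square_integrable_def)
  let ?F = "\<lambda>t. indicator {0<..<1} t *\<^sub>R (cmod (f t))\<^sup>2 :: real"
  have "integrable lebesgue ?F"
    using f by (simp add: square_integrable_def integrable_restrict_space)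
  then have "integrable lebesgue (\<lambda>t. ?F (0 + r * t))"
    using r by (intro lebesgue_integrable_real_affine) auto
  then have "integrable lebesgue (\<lambda>t. indicator {0<..<1} t *\<^sub>R ?F (r * t))"
    by (intro integrable_mult_indicator) simp_all
  then have "integrable unit_leb (\<lambda>t. ?F (r * t))"
    by (subst integrable_restrict_space) simp_all
  moreover have "integrable unit_leb (\<lambda>t. ?F (r * t)) \<longleftrightarrow> integrable unit_leb (\<lambda>t. (cmod (f (r * t)))\<^sup>2)"
    by (rule Bochner_Integration.integrable_cong) (use r sub in \<open>auto simp: indicator_def\<close>)
  ultimately show ?thesis
    using meas by (simp add: square_integrable_def)
qed

text \<open>For \<open>r\<close> outside \<open>(0,1)\<close> the dilation is set to \<open>0\<close>, a dummy value.\<close>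

lift_definition dilation :: "real \<Rightarrow> L2 \<Rightarrow> L2"
  is "\<lambda>r f. if 0 < r \<and> r < 1 then (\<lambda>x. f (r * x)) else (\<lambda>_. 0)"
proof -
  fix r :: real and f g assume fg: "ae_eq f g"
  show "ae_eq (if 0 < r \<and> r < 1 then (\<lambda>x. f (r * x)) else (\<lambda>_. 0))
              (if 0 < r \<and> r < 1 then (\<lambda>x. g (r * x)) else (\<lambda>_. 0))"
  proof (cases "0 < r \<and> r < 1")
    case True
    then show ?thesis
      using fg ae_scale[of r "\<lambda>t. f t = g t"] square_integrable_scale[of r]
      by (simp add: ae_eq_def)
  next
    case False
    then show ?thesis by (auto simp: ae_eq_def square_integrable_zero)
  qed
qed

end

theory Submission
  imports Defs
begin

text \<open>
  Write \<open>e\<^sub>n = t\<^bsup>\<lambda>\<^sub>n\<^esup>\<close>. The map \<open>t\<^sup>s \<mapsto> (s - q) / (s + q + 1) t\<^sup>s\<close> does not increase norms of linear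
  combinations of powers, and it annihilates \<open>t\<^sup>q\<close>; composing these maps isolates a single coefficient of
  \<open>p = \<Sum> a\<^sub>n e\<^sub>n\<close> and bounds \<open>\<bar>a\<^sub>n\<bar>\<close> by \<open>\<parallel>p\<parallel>\<close> times a product that grows more slowly than \<open>exp (\<epsilon> \<lambda>\<^sub>n)\<close> for
  every \<open>\<epsilon> > 0\<close>. Hence every \<open>f\<close> in the closed span has coefficients \<open>c\<^sub>n\<close> such that
  \<open>f(r t) = \<Sum> c\<^sub>n r\<^bsup>\<lambda>\<^sub>n\<^esup> e\<^sub>n\<close> converges absolutely for all \<open>0 < r < 1\<close>. The image of the unit ball therefore lies in
  the continuous image of a compact product of discs. Eigenvectors \<open>e\<^sub>0\<close>, \<open>e\<^sub>1\<close> are not orthogonal, so the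
  operator is not normal. If \<open>f\<close> lies in an invariant subspace, the rescaled iterates of \<open>f\<close> converge to its
  leading term, so that inductively every \<open>e\<^sub>n\<close> with \<open>c\<^sub>n \<noteq> 0\<close> lies there too; their closed span contains
  all dilates \<open>f(r t)\<close> and, letting \<open>r \<rightarrow> 1\<close>, also \<open>f\<close>.
\<close>

section \<open>The Hilbert space structure\<close>

lemma cinner_commute: "cinner f g = cnj (cinner g f)"
proof transfer
  fix f g assume "ae_eq f f" "ae_eq g g"
  then have "integrable unit_leb (\<lambda>t. g t * cnj (f t))"
    by (auto simp: ae_eq_def intro: integrable_mult_cnj)
  from Bochner_Integration.integral_cnj[of unit_leb "\<lambda>t. g t * cnj (f t)"]
  show "(\<integral>t. f t * cnj (g t) \<partial>unit_leb) = cnj (\<integral>t. g t * cnj (f t) \<partial>unit_leb)"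
    by (simp add: mult.commute)
qed

lemma cinner_add_left: "cinner (f + g) h = cinner f h + cinner g h"
  by transfer (auto simp: ae_eq_def distrib_right Bochner_Integration.integral_add integrable_mult_cnj)

lemma cinner_scaleC_left [simp]: "cinner (c *\<^sub>C f) g = c * cinner f g"
  by transfer (simp add: mult.assoc)

lemma cinner_add_right: "cinner f (g + h) = cinner f g + cinner f h"
  by (metis cinner_add_left cinner_commute complex_cnj_add)

lemma cinner_scaleC_right [simp]: "cinner f (c *\<^sub>C g) = cnj c * cinner f g"
  by (metis cinner_scaleC_left cinner_commute complex_cnj_mult)

lemma cinner_zero_left [simp]: "cinner 0 f = 0"
  using cinner_add_left[of 0 0 f] by simp

lemma cinner_zero_right [simp]: "cinner f 0 = 0"
  using cinner_add_right[of f 0 0] by simp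

lemma cinner_diff_left: "cinner (f - g) h = cinner f h - cinner g h"
  using cinner_add_left[of "f - g" g h] by simp

lemma cinner_diff_right: "cinner f (g - h) = cinner f g - cinner f h"
  using cinner_add_right[of f "g - h" h] by simp

lemma cinner_sum_left: "cinner (\<Sum>i\<in>A. f i) g = (\<Sum>i\<in>A. cinner (f i) g)"
  by (induction A rule: infinite_finite_induct) (simp_all add: cinner_add_left)

lemma cinner_sum_right: "cinner f (\<Sum>i\<in>A. g i) = (\<Sum>i\<in>A. cinner f (g i))"
  by (induction A rule: infinite_finite_induct) (simp_all add: cinner_add_right)

lemma cinner_self: "cinner f f = complex_of_real ((norm f)\<^sup>2)"
proof -
  have "cinner f f = cnj (cinner f f)" by (rule cinner_commute)
  then have "Im (cinner f f) = 0" by (metis complex_cnj_cancel_iff Reals_cnj_iff complex_is_Real_iff)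
  moreover have "Re (cinner f f) = (norm f)\<^sup>2"
    by (simp add: power2_norm_eq_inner inner_L2_def)
  ultimately show ?thesis by (simp add: complex_eq_iff)
qed

lemma norm_scaleC [simp]: "norm (c *\<^sub>C f) = cmod c * norm f"
proof -
  have "complex_of_real ((norm (c *\<^sub>C f))\<^sup>2) = c * cnj c * complex_of_real ((norm f)\<^sup>2)"
    by (simp only: cinner_self[symmetric] cinner_scaleC_left cinner_scaleC_right mult_ac)
  also have "\<dots> = complex_of_real ((cmod c * norm f)\<^sup>2)"
    by (simp only: complex_norm_square[symmetric] power_mult_distrib of_real_mult)
  finally have "(norm (c *\<^sub>C f))\<^sup>2 = (cmod c * norm f)\<^sup>2" by (simp only: of_real_eq_iff)
  then show ?thesis by (simp add: power2_eq_iff_nonneg)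
qed

text \<open>Makes the limit and continuity rules for bilinear maps available for complex
  scaling.\<close>

interpretation scaleC: bounded_bilinear scaleC
proof
  fix c d :: complex and f g :: L2 and r :: real
  show "(c + d) *\<^sub>C f = c *\<^sub>C f + d *\<^sub>C f" by (rule L2.scale_left_distrib)
  show "c *\<^sub>C (f + g) = c *\<^sub>C f + c *\<^sub>C g" by (rule L2.scale_right_distrib)
  show "(r *\<^sub>R c) *\<^sub>C f = r *\<^sub>R c *\<^sub>C f"
    by (simp add: scaleR_L2_def scaleR_conv_of_real)
  show "c *\<^sub>C r *\<^sub>R f = r *\<^sub>R c *\<^sub>C f"
    by (simp add: scaleR_L2_def mult.commute)
  show "\<exists>K. \<forall>c f. norm (c *\<^sub>C f) \<le> norm c * norm f * K"
    by (rule exI[of _ 1]) simp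
qed

lemma csubspace_closure:
  assumes "csubspace A" shows "csubspace (closure A)"
  unfolding L2.subspace_def
proof (intro conjI ballI allI)
  show "0 \<in> closure A" using L2.subspace_0[OF assms] closure_subset by blast
next
  fix f g assume "f \<in> closure A" "g \<in> closure A"
  then obtain u v where "\<forall>n. u n \<in> A" "u \<longlonglongrightarrow> f" "\<forall>n. v n \<in> A" "v \<longlonglongrightarrow> g"
    unfolding closure_sequential by blast
  then show "f + g \<in> closure A"
    unfolding closure_sequential
    by (intro exI[of _ "\<lambda>n. u n + v n"]) (auto intro: tendsto_add L2.subspace_add[OF assms])
next
  fix c f assume "f \<in> closure A"
  then obtain u where "\<forall>n. u n \<in> A" "u \<longlonglongrightarrow> f"
    unfolding closure_sequential by blast
  then show "c *\<^sub>C f \<in> closure A"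
    unfolding closure_sequential
    by (intro exI[of _ "\<lambda>n. c *\<^sub>C u n"])
       (auto intro: scaleC.tendsto tendsto_const L2.subspace_scale[OF assms])
qed

lemma closure_cspan_minimal:
  assumes "E \<subseteq> A" "csubspace A" "closed A" shows "closure (cspan E) \<subseteq> A"
  using assms by (intro closure_minimal L2.span_minimal)

section \<open>Classes of functions\<close>

lemma square_integrable_sum:
  "(\<And>i. i \<in> A \<Longrightarrow> square_integrable (f i)) \<Longrightarrow> square_integrable (\<lambda>t. \<Sum>i\<in>A. f i t)"
  by (induction A rule: infinite_finite_induct)
     (simp_all add: square_integrable_zero square_integrable_add)

lemma L2_of_add:
  assumes "square_integrable f" "square_integrable g"
  shows "L2_of (\<lambda>t. f t + g t) = L2_of f + L2_of g"
  using assms square_integrable_add[OF assms] by transfer (simp add: ae_eq_def)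

lemma L2_of_scaleC:
  assumes "square_integrable f"
  shows "L2_of (\<lambda>t. c * f t) = c *\<^sub>C L2_of f"
  using assms square_integrable_cmult[OF assms] by transfer (simp add: ae_eq_def)

lemma L2_of_zero [simp]: "L2_of (\<lambda>_. 0) = 0"
  by transfer (simp add: ae_eq_def square_integrable_zero)

lemma L2_of_diff:
  assumes "square_integrable f" "square_integrable g"
  shows "L2_of (\<lambda>t. f t - g t) = L2_of f - L2_of g"
  using L2_of_add[OF assms(1) square_integrable_cmult[OF assms(2), of "-1"]]
    L2_of_scaleC[OF assms(2), of "-1"] by simp

lemma L2_of_sum:
  "(\<And>i. i \<in> A \<Longrightarrow> square_integrable (f i)) \<Longrightarrow> L2_of (\<lambda>t. \<Sum>i\<in>A. f i t) = (\<Sum>i\<in>A. L2_of (f i))"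
  by (induction A rule: infinite_finite_induct) (simp_all add: L2_of_add square_integrable_sum)

lemma cinner_L2_of:
  assumes "square_integrable f" "square_integrable g"
  shows "cinner (L2_of f) (L2_of g) = (\<integral>t. f t * cnj (g t) \<partial>unit_leb)"
  using assms by transfer simp

lemma norm_L2_of:
  assumes "square_integrable f"
  shows "(norm (L2_of f))\<^sup>2 = (\<integral>t. (cmod (f t))\<^sup>2 \<partial>unit_leb)"
proof -
  have "complex_of_real ((norm (L2_of f))\<^sup>2) = (\<integral>t. complex_of_real ((cmod (f t))\<^sup>2) \<partial>unit_leb)"
    unfolding cinner_self[symmetric] cinner_L2_of[OF assms assms]
    by (intro Bochner_Integration.integral_cong refl complex_norm_square[symmetric])
  then show ?thesis
    by (simp only: integral_complex_of_real of_real_eq_iff)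
qed

lemma L2_of_cases:
  obtains f where "square_integrable f" "F = L2_of f"
proof -
  have "\<exists>f. square_integrable f \<and> F = L2_of f"
    by transfer (auto simp: ae_eq_def)
  then show ?thesis using that by blast
qed

lemma measure_unit_leb: "measure unit_leb {0<..<1} = 1"
  by (simp add: measure_restrict_space)

lemma finite_measure_unit_leb: "finite_measure unit_leb"
  by (rule finite_measureI) (simp add: emeasure_restrict_space space_restrict_space)

text \<open>The unit interval has measure 1, so a pointwise bound passes to the norm with the same
  constant.\<close>

lemma
  assumes "f \<in> borel_measurable unit_leb" "\<And>t. t \<in> {0<..<1} \<Longrightarrow> cmod (f t) \<le> B"
  shows square_integrable_bounded: "square_integrable f"
    and norm_L2_of_le: "norm (L2_of f) \<le> B"
proof -
  interpret finite_measure unit_leb by (rule finite_measure_unit_leb)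
  have [measurable]: "f \<in> borel_measurable unit_leb" by fact
  \<comment> \<open>The interval is nonempty; the point 1/2 serves only to show that the bound is
    nonnegative.\<close>
  have "0 \<le> cmod (f (1/2))" by simp
  also have "\<dots> \<le> B" by (rule assms(2)) simp
  finally have B: "0 \<le> B" .
  have b: "(cmod (f t))\<^sup>2 \<le> B\<^sup>2" if "t \<in> {0<..<1}" for t
    using assms(2)[OF that] by (simp add: power_mono)
  have i: "integrable unit_leb (\<lambda>t. (cmod (f t))\<^sup>2)"
    by (rule integrable_const_bound[of _ "B\<^sup>2"]) (auto intro!: AE_I2 simp: b)
  then show s: "square_integrable f" using assms(1) by (simp add: square_integrable_def)
  have "(norm (L2_of f))\<^sup>2 = (\<integral>t. (cmod (f t))\<^sup>2 \<partial>unit_leb)" by (rule norm_L2_of[OF s])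
  also have "\<dots> \<le> (\<integral>t. B\<^sup>2 \<partial>unit_leb)"
    by (rule integral_mono[OF i]) (auto simp: b)
  also have "\<dots> = B\<^sup>2" by (simp add: measure_unit_leb)
  finally show "norm (L2_of f) \<le> B" using B by (simp add: power2_le_iff_abs_le)
qed

section \<open>Powers\<close>

definition pw :: "real \<Rightarrow> L2" where
  "pw s = L2_of (\<lambda>t. complex_of_real (t powr s))"

lemma
  assumes "s > -1"
  shows integrable_powr_unit: "integrable unit_leb (\<lambda>t. t powr s)"
    and integral_powr_unit: "(\<integral>t. t powr s \<partial>unit_leb) = 1 / (s + 1)"
proof -
  have h: "((\<lambda>t. t powr s) has_integral 1 / (s + 1)) {0<..<1}"
    using has_integral_powr_from_0[OF assms, of 1]
    by (simp add: has_integral_Icc_iff_Ioo)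
  have "(\<lambda>t. t powr s) absolutely_integrable_on {0<..<1}"
    \<comment> \<open>Nonnegativity turns the gauge integral into an absolutely convergent one,
      which the Lebesgue integral requires.\<close>
    using h by (intro nonnegative_absolutely_integrable_1) auto
  then have a: "set_integrable lebesgue {0<..<1} (\<lambda>t. t powr s)" .
  then show "integrable unit_leb (\<lambda>t. t powr s)"
    by (simp add: set_integrable_def integrable_restrict_space)
  show "(\<integral>t. t powr s \<partial>unit_leb) = 1 / (s + 1)"
    using set_lebesgue_integral_eq_integral(2)[OF a] h
    by (simp add: integral_restrict_space set_lebesgue_integral_def integral_unique)
qed

lemma measurable_powr_unit: "(\<lambda>t. complex_of_real (t powr s)) \<in> borel_measurable unit_leb"
  by (intro measurable_restrict_space1 measurable_completion) simp

lemma square_integrable_powr: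
  assumes "s > -1/2" shows "square_integrable (\<lambda>t. complex_of_real (t powr s))"
proof -
  have "integrable unit_leb (\<lambda>t. t powr (2 * s))"
    using assms by (intro integrable_powr_unit) simp
  moreover have "(cmod (complex_of_real (t powr s)))\<^sup>2 = t powr (2 * s)" for t
    by (simp add: power2_eq_square powr_add[symmetric])
  ultimately show ?thesis
    using measurable_powr_unit[of s] by (simp only: square_integrable_def)
qed

text \<open>The Gram matrix of powers is a Cauchy matrix; every norm estimate for linear
  combinations of powers below starts from this formula.\<close>

lemma cinner_pw:
  assumes "s > -1/2" "r > -1/2"
  shows "cinner (pw s) (pw r) = complex_of_real (1 / (s + r + 1))"
proof -
  have "cinner (pw s) (pw r) = (\<integral>t. complex_of_real (t powr (s + r)) \<partial>unit_leb)"
    using assms unfolding pw_def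
    by (subst cinner_L2_of) (simp_all add: square_integrable_powr powr_add)
  also have "\<dots> = complex_of_real (\<integral>t. t powr (s + r) \<partial>unit_leb)"
    by (rule integral_complex_of_real)
  also have "\<dots> = complex_of_real (1 / (s + r + 1))"
    using assms by (subst integral_powr_unit) auto
  finally show ?thesis .
qed

lemma norm_pw:
  assumes "s > -1/2" shows "norm (pw s) = 1 / sqrt (2 * s + 1)"
proof -
  have "complex_of_real ((norm (pw s))\<^sup>2) = complex_of_real (1 / (s + s + 1))"
    using cinner_pw[OF assms assms] by (simp only: cinner_self)
  then have "(norm (pw s))\<^sup>2 = 1 / (2 * s + 1)" by (simp only: of_real_eq_iff) simp
  then have "norm (pw s) = sqrt (1 / (2 * s + 1))" by (metis norm_ge_zero real_sqrt_unique)
  then show ?thesis by (simp add: real_sqrt_divide)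
qed

lemma pw_nonzero: "s > -1/2 \<Longrightarrow> pw s \<noteq> 0"
  using norm_pw[of s] by auto

lemma norm_pw_le: "s \<ge> 0 \<Longrightarrow> norm (pw s) \<le> 1"
  by (simp add: norm_pw)

text \<open>Powers with nonnegative exponent are at most 1 on the unit interval, so the series
  converges uniformly there by the Weierstrass test. The limit is built pointwise as
  \<open>F\<close>, and the sup norm dominates the norm of \<open>L2\<close>.\<close>

lemma summable_pw:
  fixes b :: "nat \<Rightarrow> complex"
  assumes b: "summable (\<lambda>n. cmod (b n))" and lam: "\<And>n. lam n \<ge> 0"
  shows "summable (\<lambda>n. b n *\<^sub>C pw (lam n))"
proof -
  define F where "F t = (\<Sum>n. b n * complex_of_real (t powr lam n))" for t
  have le: "cmod (b n * complex_of_real (t powr lam n)) \<le> cmod (b n)" if "t \<in> {0<..<1}" for t n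
    using that lam[of n] powr_le1[of "lam n" t] by (simp add: norm_mult mult_left_le)
  have sm: "summable (\<lambda>n. cmod (b n * complex_of_real (t powr lam n)))" if "t \<in> {0<..<1}" for t
    by (rule summable_comparison_test'[OF b]) (use le[OF that] in simp)
  have mb: "(\<lambda>t. b n * complex_of_real (t powr lam n)) \<in> borel_measurable unit_leb" for n
    by (intro borel_measurable_times borel_measurable_const measurable_powr_unit)
  have mF: "F \<in> borel_measurable unit_leb"
    unfolding F_def by (rule borel_measurable_suminf[OF mb])
  have si: "square_integrable (\<lambda>t. b n * complex_of_real (t powr lam n))" for n
    by (rule square_integrable_cmult, rule square_integrable_powr) (use lam[of n] in linarith)
  have tail: "cmod (F t - (\<Sum>n<N. b n * complex_of_real (t powr lam n))) \<le> (\<Sum>n. cmod (b (n + N)))"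
    if t: "t \<in> {0<..<1}" for t N
  proof -
    have "F t - (\<Sum>n<N. b n * complex_of_real (t powr lam n))
        = (\<Sum>n. b (n + N) * complex_of_real (t powr lam (n + N)))"
      unfolding F_def using suminf_minus_initial_segment[OF summable_norm_cancel[OF sm[OF t]], of N]
      by simp
    also have "cmod \<dots> \<le> (\<Sum>n. cmod (b (n + N) * complex_of_real (t powr lam (n + N))))"
      by (rule summable_norm) (use sm[OF t] in \<open>rule summable_ignore_initial_segment\<close>)
    also have "\<dots> \<le> (\<Sum>n. cmod (b (n + N)))"
      by (intro suminf_le le t summable_ignore_initial_segment sm b)
    finally show ?thesis .
  qed
  have F0: "square_integrable F"
  proof (rule square_integrable_bounded[OF mF])
    show "cmod (F t) \<le> (\<Sum>n. cmod (b n))" if "t \<in> {0<..<1}" for t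
      using tail[OF that, of 0] by simp
  qed
  have "norm (L2_of F - (\<Sum>n<N. b n *\<^sub>C pw (lam n))) \<le> (\<Sum>n. cmod (b (n + N)))" for N
  proof -
    have "b n *\<^sub>C pw (lam n) = L2_of (\<lambda>t. b n * complex_of_real (t powr lam n))" for n
      unfolding pw_def by (rule L2_of_scaleC[symmetric], rule square_integrable_powr) (use lam[of n] in linarith)
    then have "L2_of F - (\<Sum>n<N. b n *\<^sub>C pw (lam n))
      = L2_of (\<lambda>t. F t - (\<Sum>n<N. b n * complex_of_real (t powr lam n)))"
      by (simp add: L2_of_diff F0 square_integrable_sum si L2_of_sum)
    also have "norm \<dots> \<le> (\<Sum>n. cmod (b (n + N)))"
      by (rule norm_L2_of_le) (use mF mb tail in \<open>auto intro!: borel_measurable_diff borel_measurable_sum\<close>)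
    finally show ?thesis .
  qed
  moreover have "(\<lambda>N. \<Sum>n. cmod (b (n + N))) \<longlonglongrightarrow> 0"
    by (rule suminf_exist_split2[OF b])
  ultimately have "(\<lambda>N. L2_of F - (\<Sum>n<N. b n *\<^sub>C pw (lam n))) \<longlonglongrightarrow> 0"
    by (rule Lim_null_comparison[OF always_eventually, OF allI])
  then have "(\<lambda>N. L2_of F - (L2_of F - (\<Sum>n<N. b n *\<^sub>C pw (lam n)))) \<longlonglongrightarrow> L2_of F - 0"
    by (intro tendsto_diff tendsto_const)
  then show ?thesis by (auto simp: summable_def sums_def)
qed

section \<open>Dilations\<close>

lemma dilation_L2_of:
  assumes "0 < r" "r < 1" "square_integrable f"
  shows "dilation r (L2_of f) = L2_of (\<lambda>x. f (r * x))"
  using assms square_integrable_scale[OF assms] by transfer (simp add: ae_eq_def)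

lemma dilation_add: "dilation r (f + g) = dilation r f + dilation r g"
  by transfer (auto simp: ae_eq_def square_integrable_zero intro!: square_integrable_add square_integrable_scale)

lemma dilation_scaleC: "dilation r (c *\<^sub>C f) = c *\<^sub>C dilation r f"
  by transfer (auto simp: ae_eq_def square_integrable_zero intro!: square_integrable_cmult square_integrable_scale)

lemma dilation_dilation:
  assumes "0 < r" "r < 1" "0 < s" "s < 1"
  shows "dilation r (dilation s f) = dilation (r * s) f"
proof -
  obtain g where g: "square_integrable g" "f = L2_of g" by (rule L2_of_cases)
  have "r * s < 1" using mult_strict_mono[of r 1 s 1] assms by simp
  then show ?thesis using assms g
    by (simp add: dilation_L2_of square_integrable_scale mult.assoc mult.left_commute)
qed

text \<open>Substituting \<open>x = r * t\<close> costs a factor 1 / r in the squared norm. The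
  integrand is extended by zero to the whole line, where the affine substitution is exact.\<close>

lemma norm_dilation_le:
  assumes r: "0 < r" "r < 1" shows "norm (dilation r f) \<le> norm f / sqrt r"
proof -
  obtain g where g: "square_integrable g" "f = L2_of g" by (rule L2_of_cases)
  have sub: "r * t < 1" if "0 < t" "t < 1" for t
    using mult_strict_mono[of r 1 t 1] r that by simp
  let ?G = "\<lambda>t. indicator {0<..<1} t *\<^sub>R (cmod (g t))\<^sup>2 :: real"
  have iG: "integrable lebesgue ?G"
    using g by (simp add: square_integrable_def integrable_restrict_space)
  have iG': "integrable lebesgue (\<lambda>t. ?G (0 + r * t))"
    using iG r by (intro lebesgue_integrable_real_affine) auto
  have s: "square_integrable (\<lambda>x. g (r * x))" using r g by (intro square_integrable_scale)
  have "(norm (dilation r f))\<^sup>2 = (\<integral>t. (cmod (g (r * t)))\<^sup>2 \<partial>unit_leb)"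
    using g r norm_L2_of[OF s] by (simp add: dilation_L2_of)
  also have "\<dots> = (\<integral>t. indicator {0<..<1} t *\<^sub>R (cmod (g (r * t)))\<^sup>2 \<partial>lebesgue)"
    by (subst integral_restrict_space) simp_all
  \<comment> \<open>The right side integrates over (0, 1/r), which contains the unit interval; this
    is the only inequality in the chain.\<close>
  also have "\<dots> \<le> (\<integral>t. ?G (0 + r * t) \<partial>lebesgue)"
  proof (rule integral_mono[OF _ iG'])
    show "integrable lebesgue (\<lambda>t. indicator {0<..<1} t *\<^sub>R (cmod (g (r * t)))\<^sup>2)"
      using s by (simp add: square_integrable_def integrable_restrict_space)
  qed (use r sub in \<open>auto simp: indicator_def\<close>)
  also have "\<dots> = (\<integral>t. ?G t \<partial>lebesgue) / r"
    using lebesgue_integral_real_affine[of r ?G 0] r by simp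
  also have "(\<integral>t. ?G t \<partial>lebesgue) = (norm f)\<^sup>2"
    using g by (simp add: norm_L2_of integral_restrict_space)
  finally have "norm (dilation r f) \<le> sqrt ((norm f)\<^sup>2 / r)" by (rule real_le_rsqrt)
  then show ?thesis using r by (simp add: real_sqrt_divide)
qed

lemma bounded_linear_dilation:
  assumes "0 < r" "r < 1" shows "bounded_linear (dilation r)"
  by (rule bounded_linear_intro[of _ "1 / sqrt r"])
     (use norm_dilation_le[OF assms] in \<open>auto simp: dilation_add scaleR_L2_def dilation_scaleC\<close>)

lemma dilation_pw:
  assumes "0 < r" "r < 1" "s > -1/2"
  shows "dilation r (pw s) = complex_of_real (r powr s) *\<^sub>C pw s"
proof -
  have "dilation r (pw s) = L2_of (\<lambda>t. complex_of_real ((r * t) powr s))"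
    unfolding pw_def using assms by (simp add: dilation_L2_of square_integrable_powr)
  also have "\<dots> = L2_of (\<lambda>t. complex_of_real (r powr s) * complex_of_real (t powr s))"
    using assms by (simp add: powr_mult)
  also have "\<dots> = complex_of_real (r powr s) *\<^sub>C pw s"
    unfolding pw_def by (rule L2_of_scaleC) (rule square_integrable_powr[OF assms(3)])
  finally show ?thesis .
qed

lemma dilation_zero [simp]: "dilation r 0 = 0"
  using dilation_scaleC[of r 0 0] by simp

lemma dilation_diff: "dilation r (f - g) = dilation r f - dilation r g"
  using dilation_add[of r "f - g" g] by simp

lemma dilation_sum: "dilation r (\<Sum>i\<in>A. f i) = (\<Sum>i\<in>A. dilation r (f i))"
  by (induction A rule: infinite_finite_induct) (simp_all add: dilation_add)

section \<open>Lower bounds for linear combinations of powers\<close>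

lemma cinner_sum_pw:
  fixes lam :: "'i \<Rightarrow> real"
  assumes "\<And>i. i \<in> S \<Longrightarrow> lam i > -1/2"
  shows "cinner (\<Sum>i\<in>S. a i *\<^sub>C pw (lam i)) (\<Sum>i\<in>S. a i *\<^sub>C pw (lam i))
    = (\<Sum>i\<in>S. \<Sum>j\<in>S. a i * cnj (a j) * complex_of_real (1 / (lam i + lam j + 1)))"
  by (subst cinner_sum_left, subst cinner_sum_right)
     (intro sum.cong refl, use assms in \<open>simp add: cinner_pw\<close>)

text \<open>On the Mellin side the map is multiplication by a Blaschke factor; the loss in the squared norm of \<open>f\<close>
  is \<open>(2q + 1) \<bar>\<langle>f, t\<^sup>q\<rangle>\<bar>\<^sup>2\<close>.\<close>

lemma norm_blaschke_le:
  fixes lam :: "'i \<Rightarrow> real"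
  assumes lam: "\<And>i. i \<in> S \<Longrightarrow> lam i > -1/2" and q: "q > -1/2"
  shows "norm (\<Sum>i\<in>S. (a i * complex_of_real ((lam i - q) / (lam i + q + 1))) *\<^sub>C pw (lam i))
    \<le> norm (\<Sum>i\<in>S. a i *\<^sub>C pw (lam i))"
proof -
  define k where "k i = (lam i - q) / (lam i + q + 1)" for i
  define z where "z = (\<Sum>i\<in>S. a i * complex_of_real (1 / (lam i + q + 1)))"
  have aux: "1 / w - A / U * (B / V) * (1 / w) = (U * V - A * B) / (U * V * w)"
    if "w \<noteq> 0" "U \<noteq> 0" "V \<noteq> 0" for w A B U V :: real
    using that by (simp add: field_simps)
  have aux2: "c * w / (U * V * w) = c * (1 / U) * (1 / V)" if "w \<noteq> 0" for c w U V :: real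
    using that by simp
  \<comment> \<open>The Cauchy denominator \<open>x + y + 1\<close> cancels, leaving a product of a
    factor in \<open>x\<close> and a factor in \<open>y\<close>. The double sum therefore collapses
    to the square of the modulus of \<open>z\<close>, the inner product of the combination with
    \<open>pw q\<close>.\<close>
  have alg: "1 / (x + y + 1) - (x - q) / (x + q + 1) * ((y - q) / (y + q + 1)) * (1 / (x + y + 1))
      = (2 * q + 1) * (1 / (x + q + 1)) * (1 / (y + q + 1))"
    if "x > -1/2" "y > -1/2" for x y
  proof -
    have "x + y + 1 \<noteq> 0" "x + q + 1 \<noteq> 0" "y + q + 1 \<noteq> 0" using that q by linarith+
    then have "1 / (x + y + 1) - (x - q) / (x + q + 1) * ((y - q) / (y + q + 1)) * (1 / (x + y + 1))
        = ((x + q + 1) * (y + q + 1) - (x - q) * (y - q)) / ((x + q + 1) * (y + q + 1) * (x + y + 1))"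
      by (rule aux)
    also have "(x + q + 1) * (y + q + 1) - (x - q) * (y - q) = (2 * q + 1) * (x + y + 1)"
      by (simp add: algebra_simps)
    finally show ?thesis by (simp only: aux2[OF \<open>x + y + 1 \<noteq> 0\<close>])
  qed
  have zz: "z * cnj z = (\<Sum>i\<in>S. \<Sum>j\<in>S. a i * complex_of_real (1 / (lam i + q + 1)) *
      (cnj (a j) * complex_of_real (1 / (lam j + q + 1))))"
    by (simp only: z_def cnj_sum sum_product complex_cnj_mult complex_cnj_complex_of_real)
  have cs: "cinner (\<Sum>i\<in>S. b i *\<^sub>C pw (lam i)) (\<Sum>i\<in>S. b i *\<^sub>C pw (lam i))
    = (\<Sum>i\<in>S. \<Sum>j\<in>S. b i * cnj (b j) * complex_of_real (1 / (lam i + lam j + 1)))" for b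
    by (rule cinner_sum_pw) (rule lam)
  have "cinner (\<Sum>i\<in>S. a i *\<^sub>C pw (lam i)) (\<Sum>i\<in>S. a i *\<^sub>C pw (lam i))
      - cinner (\<Sum>i\<in>S. (a i * complex_of_real (k i)) *\<^sub>C pw (lam i))
               (\<Sum>i\<in>S. (a i * complex_of_real (k i)) *\<^sub>C pw (lam i))
      = (\<Sum>i\<in>S. \<Sum>j\<in>S. a i * cnj (a j) *
          complex_of_real (1 / (lam i + lam j + 1) - k i * k j * (1 / (lam i + lam j + 1))))"
    unfolding cs sum_subtractf[symmetric]
    by (intro sum.cong refl) (simp only: of_real_diff of_real_mult complex_cnj_mult
      complex_cnj_complex_of_real right_diff_distrib mult_ac)
  also have "\<dots> = (\<Sum>i\<in>S. \<Sum>j\<in>S. a i * cnj (a j) *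
          complex_of_real ((2 * q + 1) * (1 / (lam i + q + 1)) * (1 / (lam j + q + 1))))"
    unfolding k_def by (intro sum.cong refl) (simp only: alg lam)
  also have "\<dots> = complex_of_real (2 * q + 1) * (z * cnj z)"
    unfolding zz sum_distrib_left
    by (intro sum.cong refl) (simp only: of_real_mult mult_ac)
  also have "\<dots> = complex_of_real ((2 * q + 1) * (cmod z)\<^sup>2)"
    by (simp only: complex_norm_square[symmetric] of_real_mult)
  finally have "(norm (\<Sum>i\<in>S. a i *\<^sub>C pw (lam i)))\<^sup>2
      - (norm (\<Sum>i\<in>S. (a i * complex_of_real (k i)) *\<^sub>C pw (lam i)))\<^sup>2 = (2 * q + 1) * (cmod z)\<^sup>2"
    by (simp only: cinner_self of_real_diff[symmetric] of_real_eq_iff)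
  moreover have "(2 * q + 1) * (cmod z)\<^sup>2 \<ge> 0" using q by simp
  ultimately have "(norm (\<Sum>i\<in>S. (a i * complex_of_real (k i)) *\<^sub>C pw (lam i)))\<^sup>2
      \<le> (norm (\<Sum>i\<in>S. a i *\<^sub>C pw (lam i)))\<^sup>2"
    by linarith
  then show ?thesis unfolding k_def by (rule power2_le_imp_le) (rule norm_ge_zero)
qed

lemma norm_blaschke_prod_le:
  fixes lam :: "'i \<Rightarrow> real"
  assumes lam: "\<And>i. i \<in> S \<Longrightarrow> lam i > -1/2"
    and "finite Q" "\<And>q. q \<in> Q \<Longrightarrow> lam q > -1/2"
  shows "norm (\<Sum>i\<in>S. (a i * complex_of_real (\<Prod>q\<in>Q. (lam i - lam q) / (lam i + lam q + 1))) *\<^sub>C pw (lam i))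
    \<le> norm (\<Sum>i\<in>S. a i *\<^sub>C pw (lam i))"
  using assms(2,3)
proof (induction Q rule: finite_induct)
  case (insert p Q)
  define b where "b i = a i * complex_of_real (\<Prod>q\<in>Q. (lam i - lam q) / (lam i + lam q + 1))" for i
  have "a i * complex_of_real (\<Prod>q\<in>insert p Q. (lam i - lam q) / (lam i + lam q + 1))
      = b i * complex_of_real ((lam i - lam p) / (lam i + lam p + 1))" for i
    unfolding b_def using insert(1,2) by (simp add: mult_ac)
  then have "norm (\<Sum>i\<in>S. (a i * complex_of_real (\<Prod>q\<in>insert p Q. (lam i - lam q) / (lam i + lam q + 1)))
        *\<^sub>C pw (lam i)) \<le> norm (\<Sum>i\<in>S. b i *\<^sub>C pw (lam i))"
    using norm_blaschke_le[of S lam "lam p" b] lam insert.prems[of p] by (simp only: insertI1)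
  also have "\<dots> \<le> norm (\<Sum>i\<in>S. a i *\<^sub>C pw (lam i))"
    unfolding b_def using insert.IH insert.prems by simp
  finally show ?case .
qed simp

text \<open>Blaschke factors with zeros at all other exponents leave only the term \<open>k\<close>,
  multiplied by \<open>?P k\<close>. The product in the bound inverts that multiplier, and the
  square root inverts the norm of \<open>pw (lam k)\<close>.\<close>

lemma coefficient_bound:
  fixes lam :: "'i \<Rightarrow> real"
  assumes S: "finite S" "k \<in> S" and lam: "\<And>i. i \<in> S \<Longrightarrow> lam i > -1/2" and inj: "inj_on lam S"
  shows "cmod (a k) \<le> sqrt (2 * lam k + 1) * (\<Prod>i\<in>S-{k}. (lam k + lam i + 1) / \<bar>lam k - lam i\<bar>)
      * norm (\<Sum>i\<in>S. a i *\<^sub>C pw (lam i))"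
proof -
  let ?P = "\<lambda>i. \<Prod>q\<in>S-{k}. (lam i - lam q) / (lam i + lam q + 1)"
  have "(\<Sum>i\<in>S. (a i * complex_of_real (?P i)) *\<^sub>C pw (lam i))
      = (\<Sum>i\<in>{k}. (a i * complex_of_real (?P i)) *\<^sub>C pw (lam i))"
    using S by (intro sum.mono_neutral_right ballI) auto
  then have "norm ((a k * complex_of_real (?P k)) *\<^sub>C pw (lam k)) \<le> norm (\<Sum>i\<in>S. a i *\<^sub>C pw (lam i))"
    using norm_blaschke_prod_le[of S lam "S-{k}" a] lam S by simp
  then have 1: "cmod (a k) * \<bar>?P k\<bar> / sqrt (2 * lam k + 1) \<le> norm (\<Sum>i\<in>S. a i *\<^sub>C pw (lam i))"
    by (simp only: norm_scaleC norm_mult norm_of_real norm_pw[OF lam[OF S(2)]]) simp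
  have inv: "\<bar>?P k\<bar> * (\<Prod>i\<in>S-{k}. (lam k + lam i + 1) / \<bar>lam k - lam i\<bar>) = 1"
    unfolding abs_prod prod.distrib[symmetric]
  proof (intro prod.neutral ballI)
    fix i assume i: "i \<in> S - {k}"
    then have "lam k + lam i + 1 > 0" "lam k \<noteq> lam i"
      using lam[of k] lam[of i] S inj by (auto simp: inj_on_def)
    then show "\<bar>(lam k - lam i) / (lam k + lam i + 1)\<bar> * ((lam k + lam i + 1) / \<bar>lam k - lam i\<bar>) = 1"
      by (simp only: abs_divide) simp
  qed
  have "0 \<le> (\<Prod>i\<in>S-{k}. (lam k + lam i + 1) / \<bar>lam k - lam i\<bar>)"
  proof (intro prod_nonneg divide_nonneg_nonneg abs_ge_zero)
    show "0 \<le> lam k + lam i + 1" if "i \<in> S - {k}" for i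
      using lam[of k] lam[of i] S that by simp
  qed
  moreover have "0 < sqrt (2 * lam k + 1)" using lam[OF S(2)] by simp
  ultimately have "cmod (a k) * \<bar>?P k\<bar> * (\<Prod>i\<in>S-{k}. (lam k + lam i + 1) / \<bar>lam k - lam i\<bar>)
    \<le> norm (\<Sum>i\<in>S. a i *\<^sub>C pw (lam i)) * sqrt (2 * lam k + 1) * (\<Prod>i\<in>S-{k}. (lam k + lam i + 1) / \<bar>lam k - lam i\<bar>)"
    using 1 by (intro mult_right_mono) (simp_all add: divide_le_eq)
  then show ?thesis by (simp only: mult.assoc inv) (simp only: mult_ac mult_1_right)
qed

section \<open>Subexponential growth of the coefficient bounds\<close>

text \<open>The i-th smallest element of a set of positive integers is at least i. The induction
  adds the largest element last.\<close>

lemma fact_card_le_prod: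
  fixes J :: "nat set"
  assumes "finite J" "0 \<notin> J" shows "fact (card J) \<le> \<Prod>J"
  using assms
proof (induction J rule: finite_linorder_max_induct)
  case (insert b A)
  have "A \<subseteq> {1..<b}"
  proof
    fix x assume "x \<in> A"
    then show "x \<in> {1..<b}" using insert by (cases x) auto
  qed
  then have "card A \<le> card {1..<b}" by (intro card_mono) auto
  then have "Suc (card A) \<le> b" using insert by (cases b) auto
  moreover have "b \<notin> A" using insert by auto
  ultimately show ?case using insert by (simp add: mult_mono del: mult_Suc)
qed simp

lemma power_fact_le_exp:
  assumes "x \<ge> (0::real)" shows "x ^ k / fact k \<le> exp x"
proof -
  have "(\<lambda>n. x ^ n / fact n) sums exp x"
    using exp_converges[of x] by (simp add: scaleR_conv_of_real divide_inverse mult.commute)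
  then have "(\<Sum>n\<in>{k}. x ^ n / fact n) \<le> exp x"
    using assms by (metis (no_types, lifting) sums_iff sum_le_suminf finite.emptyI finite_insert
      divide_nonneg_pos fact_gt_zero zero_le_power)
  then show ?thesis by simp
qed

text \<open>\<open>\<eta>\<close> is a trade-off parameter: a small value makes the exponential
  cheap in \<open>A\<close>, at the price of a power with exponent \<open>card J\<close>. This pays
  off when \<open>J\<close> has few elements compared with \<open>A\<close>.\<close>

lemma prod_divide_le_exp:
  fixes J :: "nat set" and A \<eta> :: real
  assumes J: "finite J" "0 \<notin> J" and A: "A \<ge> 0" and \<eta>: "0 < \<eta>"
  shows "(\<Prod>j\<in>J. A / real j) \<le> (1 / \<eta>) ^ card J * exp (\<eta> * A)"
proof -
  have "real (fact (card J)) \<le> real (\<Prod>J)"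
    using fact_card_le_prod[OF J] by (simp only: of_nat_le_iff)
  then have f: "fact (card J) \<le> (\<Prod>j\<in>J. real j)" by (simp add: id_def)
  have "(\<Prod>j\<in>J. A / real j) = A ^ card J / (\<Prod>j\<in>J. real j)"
    by (simp add: prod_dividef)
  also have "\<dots> \<le> A ^ card J / fact (card J)"
    using f A by (intro divide_left_mono mult_pos_pos) (auto intro: less_le_trans[OF fact_gt_zero])
  also have "\<dots> = (1 / \<eta>) ^ card J * ((\<eta> * A) ^ card J / fact (card J))"
    using \<eta> by (simp add: power_mult_distrib power_divide)
  also have "\<dots> \<le> (1 / \<eta>) ^ card J * exp (\<eta> * A)"
    using \<eta> A by (intro mult_left_mono power_fact_le_exp) auto
  finally show ?thesis .
qed

section \<open>Exponents with gaps and summable reciprocals: counting and product estimates\<close>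

locale muntz_exponents =
  fixes lam :: "nat \<Rightarrow> real" and \<delta> :: real
  assumes lam_pos: "\<And>n. 0 < lam n"
    and summable_inverse: "summable (\<lambda>n. 1 / lam n)"
    and \<delta>_pos: "0 < \<delta>"
    and gap: "\<And>n. \<delta> \<le> lam (Suc n) - lam n"
begin

lemma gap_add: "\<delta> * real k \<le> lam (n + k) - lam n"
proof (induction k)
  case (Suc k)
  then show ?case using gap[of "n + k"] by (simp add: algebra_simps)
qed simp

text \<open>With truncated subtraction, \<open>(m - n) + (n - m)\<close> is the distance of
  \<open>m\<close> and \<open>n\<close> as a natural number.\<close>

lemma gap_le: "\<delta> * real ((m - n) + (n - m)) \<le> \<bar>lam n - lam m\<bar>"
proof (cases "n \<le> m")
  case True
  then show ?thesis using gap_add[of "m - n" n] by simp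
next
  case False
  then show ?thesis using gap_add[of "n - m" m] by simp
qed

lemma strict_mono_lam: "strict_mono lam"
  unfolding strict_mono_Suc_iff using gap \<delta>_pos by (metis diff_gt_0_iff_gt less_le_trans)

lemma lam_eq_iff: "lam m = lam n \<longleftrightarrow> m = n"
  using strict_mono_lam by (simp add: strict_mono_eq)

lemma lam_0_le: "lam 0 \<le> lam n"
  using strict_mono_lam by (simp add: strict_mono_less_eq)

text \<open>Quantifying over finite sets lets the tail bound apply directly to arbitrary finite
  subfamilies of indices.\<close>

definition tail_le :: "nat \<Rightarrow> real \<Rightarrow> bool" where
  "tail_le M \<theta> \<longleftrightarrow> (\<forall>F. finite F \<longrightarrow> F \<subseteq> {M..} \<longrightarrow> (\<Sum>m\<in>F. 1 / lam m) \<le> \<theta>)"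

lemma tail_inverse:
  assumes "\<theta> > 0"
  obtains M where "tail_le M \<theta>"
proof -
  have "(\<lambda>M. \<Sum>n. 1 / lam (n + M)) \<longlonglongrightarrow> 0"
    by (rule suminf_exist_split2[OF summable_inverse])
  then have "\<forall>\<^sub>F M in sequentially. (\<Sum>n. 1 / lam (n + M)) < \<theta>"
    using assms by (rule order_tendstoD)
  then obtain M where M: "(\<Sum>n. 1 / lam (n + M)) < \<theta>"
    by (meson eventually_happens sequentially_bot)
  show ?thesis
  proof (rule that, unfold tail_le_def, intro allI impI)
    fix F :: "nat set" assume F: "finite F" "F \<subseteq> {M..}"
    have "(\<Sum>m\<in>F. 1 / lam m) = (\<Sum>n\<in>(\<lambda>m. m - M) ` F. 1 / lam (n + M))"
    proof (subst sum.reindex)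
      show "inj_on (\<lambda>m. m - M) F"
        using F(2) by (intro inj_on_diff_nat) auto
      show "(\<Sum>m\<in>F. 1 / lam m) = sum ((\<lambda>n. 1 / lam (n + M)) \<circ> (\<lambda>m. m - M)) F"
        using F(2) by (intro sum.cong refl) auto
    qed
    also have "\<dots> \<le> (\<Sum>n. 1 / lam (n + M))"
      using F(1) lam_pos
      by (intro sum_le_suminf summable_ignore_initial_segment summable_inverse) (auto intro: less_imp_le)
    finally show "(\<Sum>m\<in>F. 1 / lam m) \<le> \<theta>" using M by simp
  qed
qed

text \<open>Each index from \<open>M\<close> on with exponent below \<open>x\<close> contributes
  more than 1 / x to a sum that is at most \<open>\<theta>\<close>. Since \<open>\<theta>\<close>
  can be made arbitrarily small, the exponents have density zero.\<close>

lemma card_le: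
  assumes M: "tail_le M \<theta>"
    and J: "finite J" "\<And>m. m \<in> J \<Longrightarrow> lam m < x" and x: "0 < x"
  shows "real (card J) \<le> real M + \<theta> * x"
proof -
  let ?J = "J \<inter> {M..}"
  have "real (card ?J) * (1 / x) = (\<Sum>m\<in>?J. 1 / x)" by simp
  also have "\<dots> \<le> (\<Sum>m\<in>?J. 1 / lam m)"
    using J lam_pos x by (intro sum_mono divide_left_mono mult_pos_pos) (auto intro: less_imp_le)
  also have "\<dots> \<le> \<theta>" using J M unfolding tail_le_def by simp
  finally have "real (card ?J) \<le> \<theta> * x" using x by (simp add: divide_le_eq)
  moreover have "card J \<le> card ({..<M} \<union> ?J)" using J by (intro card_mono) auto
  moreover have "card ({..<M} \<union> ?J) \<le> card {..<M} + card ?J" by (rule card_Un_le)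
  ultimately show ?thesis by simp
qed

text \<open>The reciprocal modulus of a Blaschke factor. On the diagonal the value is 0, as division
  by zero gives 0.\<close>

abbreviation factor :: "nat \<Rightarrow> nat \<Rightarrow> real" where
  "factor n m \<equiv> (lam n + lam m + 1) / \<bar>lam n - lam m\<bar>"

lemma factor_nonneg: "0 \<le> factor n m"
  using lam_pos[of n] lam_pos[of m] by simp

text \<open>For exponents at least twice \<open>lam n\<close>, the factor is 1 plus a quantity of at
  most \<open>(4 * lam n + 2) / lam m\<close>, so the product is bounded by the exponential of a sum
  of reciprocals.\<close>

lemma prod_far:
  assumes M: "tail_le M \<theta>"
    and J: "finite J" "\<And>m. m \<in> J \<Longrightarrow> 2 * lam n \<le> lam m"
  shows "(\<Prod>m\<in>J. factor n m) \<le> exp (real M * (2 + 2 / lam 0) + (4 * lam n + 2) * \<theta>)"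
proof -
  have "factor n m \<le> exp ((4 * lam n + 2) * (1 / lam m))" if "m \<in> J" for m
  proof -
    have p: "0 < lam m - lam n" "lam m \<le> 2 * (lam m - lam n)" "0 < lam m" "0 < lam n"
      using J(2)[OF that] lam_pos[of n] lam_pos[of m] by simp_all
    then have "factor n m = 1 + (2 * lam n + 1) / (lam m - lam n)"
      by (simp add: field_simps)
    also have "(2 * lam n + 1) / (lam m - lam n) \<le> (2 * lam n + 1) / (lam m / 2)"
      using p by (intro divide_left_mono) auto
    also have "\<dots> = (4 * lam n + 2) * (1 / lam m)" using p by (simp add: field_simps)
    finally have "factor n m \<le> 1 + (4 * lam n + 2) * (1 / lam m)" by simp
    then show ?thesis using exp_ge_add_one_self order_trans by blast
  qed
  then have "(\<Prod>m\<in>J. factor n m) \<le> (\<Prod>m\<in>J. exp ((4 * lam n + 2) * (1 / lam m)))"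
    by (intro prod_mono conjI factor_nonneg)
  also have "\<dots> = exp (\<Sum>m\<in>J. (4 * lam n + 2) * (1 / lam m))"
    using J by (simp add: exp_sum)
  also have "(\<Sum>m\<in>J. (4 * lam n + 2) * (1 / lam m)) =
      (\<Sum>m\<in>J \<inter> {..<M}. (4 * lam n + 2) * (1 / lam m)) + (\<Sum>m\<in>J \<inter> {M..}. (4 * lam n + 2) * (1 / lam m))"
    using J by (subst sum.union_disjoint[symmetric]) (auto intro!: sum.cong)
  \<comment> \<open>The tail bound is silent below \<open>M\<close>, but there are at most
    \<open>M\<close> such terms, each bounded independently of \<open>n\<close> because
    \<open>2 * lam n \<le> lam m\<close>.\<close>
  also have "(\<Sum>m\<in>J \<inter> {..<M}. (4 * lam n + 2) * (1 / lam m)) \<le> real M * (2 + 2 / lam 0)"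
  proof -
    have "(4 * lam n + 2) * (1 / lam m) \<le> 2 + 2 / lam 0" if "m \<in> J" for m
    proof -
      have "(4 * lam n + 2) * (1 / lam m) = 2 * (2 * lam n / lam m) + 2 / lam m"
        by (simp add: add_divide_distrib)
      moreover have "2 * lam n / lam m \<le> 1" using J(2)[OF that] lam_pos[of m] by simp
      moreover have "2 / lam m \<le> 2 / lam 0"
        using lam_0_le[of m] lam_pos by (intro divide_left_mono mult_pos_pos) auto
      ultimately show ?thesis by linarith
    qed
    then have "(\<Sum>m\<in>J \<inter> {..<M}. (4 * lam n + 2) * (1 / lam m))
        \<le> real (card (J \<inter> {..<M})) * (2 + 2 / lam 0)"
      by (intro sum_bounded_above) auto
    also have "card (J \<inter> {..<M}) \<le> card {..<M}" by (intro card_mono) auto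
    then have "real (card (J \<inter> {..<M})) * (2 + 2 / lam 0) \<le> real M * (2 + 2 / lam 0)"
      using lam_pos[of 0] by (intro mult_right_mono) auto
    finally show ?thesis .
  qed
  also have "(\<Sum>m\<in>J \<inter> {M..}. (4 * lam n + 2) * (1 / lam m)) \<le> (4 * lam n + 2) * \<theta>"
    unfolding sum_distrib_left[symmetric]
    using J M lam_pos[of n] unfolding tail_le_def by (intro mult_left_mono) auto
  finally show ?thesis by simp
qed

text \<open>Numerators are below \<open>3 * lam n + 1\<close> and denominators at least
  \<open>\<delta>\<close> times the index distance. The hypothesis \<open>inj\<close> makes these
  distances distinct positive integers, so that the factorial estimate applies;
  \<open>card_le\<close> then bounds the number of factors.\<close>

lemma prod_near:
  assumes M: "tail_le M \<theta>"
    and J: "finite J" "n \<notin> J" "\<And>m. m \<in> J \<Longrightarrow> lam m < 2 * lam n"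
    and inj: "inj_on (\<lambda>m. (m - n) + (n - m)) J"
    and \<eta>: "0 < \<eta>" "\<eta> < 1"
  shows "(\<Prod>m\<in>J. factor n m)
    \<le> exp ((real M + \<theta> * (2 * lam n)) * ln (1 / \<eta>) + \<eta> * ((3 * lam n + 1) / \<delta>))"
proof -
  let ?d = "\<lambda>m. (m - n) + (n - m)" and ?A = "(3 * lam n + 1) / \<delta>"
  have A: "0 \<le> ?A" using lam_pos[of n] \<delta>_pos by simp
  have "factor n m \<le> ?A / real (?d m)" if m: "m \<in> J" for m
  proof -
    have d: "0 < ?d m" using m J(2) by (metis add_is_0 diff_is_0_eq gr0I le_antisym)
    have "factor n m \<le> (3 * lam n + 1) / (\<delta> * real (?d m))"
    proof (rule frac_le)
      show "lam n + lam m + 1 \<le> 3 * lam n + 1" using J(3)[OF m] by simp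
      show "0 < \<delta> * real (?d m)" using d by (intro mult_pos_pos \<delta>_pos) (simp only: of_nat_0_less_iff)
    qed (use gap_le[of m n] lam_pos[of n] in auto)
    then show ?thesis by simp
  qed
  then have "(\<Prod>m\<in>J. factor n m) \<le> (\<Prod>m\<in>J. ?A / real (?d m))"
    by (intro prod_mono conjI factor_nonneg)
  also have "\<dots> = (\<Prod>j\<in>?d ` J. ?A / real j)"
    by (subst prod.reindex[OF inj]) simp
  also have "\<dots> \<le> (1 / \<eta>) ^ card (?d ` J) * exp (\<eta> * ?A)"
    using J(2) by (intro prod_divide_le_exp A \<eta> finite_imageI J) auto
  also have "card (?d ` J) = card J" by (rule card_image[OF inj])
  also have "(1 / \<eta>) ^ card J = exp (real (card J) * ln (1 / \<eta>))"
    using \<eta> by (simp add: exp_of_nat_mult)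
  also have "\<dots> \<le> exp ((real M + \<theta> * (2 * lam n)) * ln (1 / \<eta>))"
    using \<eta> lam_pos[of n] card_le[OF M J(1), of "2 * lam n"] J(3)
    by (intro exp_mono mult_right_mono) auto
  finally show ?thesis by (simp add: exp_add)
qed

lemma prod_factor_subexponential:
  assumes \<epsilon>: "\<epsilon> > 0"
  shows "\<exists>C>0. \<forall>n N. (\<Prod>m\<in>{..<N}-{n}. factor n m) \<le> C * exp (\<epsilon> * lam n)"
proof -
  \<comment> \<open>The constants are chosen in the order \<open>\<eta>\<close>,
    \<open>\<theta>\<close>, \<open>M\<close>. This choice makes
    \<open>6 * (\<eta> / \<delta>)\<close> at most half of \<open>\<epsilon>\<close>; the cap 1/2
    keeps the logarithm \<open>l\<close> positive.\<close>
  define \<eta> where "\<eta> = min (1/2) (\<epsilon> * \<delta> / 12)"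
  have \<eta>: "0 < \<eta>" "\<eta> < 1" "12 * \<eta> \<le> \<epsilon> * \<delta>" using \<epsilon> \<delta>_pos by (auto simp: \<eta>_def)
  define l where "l = ln (1 / \<eta>)"
  have l: "l > 0" using \<eta> by (simp add: l_def)
  \<comment> \<open>The tail size is adapted to \<open>l\<close>, so that the terms with
    \<open>\<theta> * lam n\<close> use up the other half of \<open>\<epsilon>\<close>.\<close>
  define \<theta> where "\<theta> = \<epsilon> / (8 * (1 + l))"
  have \<theta>: "\<theta> > 0" "4 * \<theta> * (1 + l) = \<epsilon> / 2" using \<epsilon> l by (auto simp: \<theta>_def field_simps)
  obtain M where M: "tail_le M \<theta>"
    using tail_inverse[OF \<theta>(1)] by blast
  \<comment> \<open>Collects the parts of the three exponents that do not depend on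
    \<open>n\<close>.\<close>
  define c where "c = real M * (2 + 2 / lam 0) + 2 * \<theta> + 2 * (real M * l) + 2 * (\<eta> / \<delta>)"
  have "(\<Prod>m\<in>{..<N}-{n}. factor n m) \<le> exp c * exp (\<epsilon> * lam n)" for n N
  proof -
    define F where "F = {m. m < N \<and> 2 * lam n \<le> lam m}"
    \<comment> \<open>The near indices are split at \<open>n\<close> because the distance to
      \<open>n\<close> is injective only on each side.\<close>
    define L where "L = {m. m < N \<and> m < n \<and> lam m < 2 * lam n}"
    define R where "R = {m. m < N \<and> n < m \<and> lam m < 2 * lam n}"
    have "n \<notin> F" using lam_pos[of n] by (simp add: F_def)
    then have dec: "{..<N}-{n} = F \<union> (L \<union> R)" by (auto simp: F_def L_def R_def)
    have fin: "finite F" "finite L" "finite R" by (auto simp: F_def L_def R_def)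
    have dis: "F \<inter> (L \<union> R) = {}" "L \<inter> R = {}" by (auto simp: F_def L_def R_def)
    let ?E = "(real M + \<theta> * (2 * lam n)) * l + \<eta> * ((3 * lam n + 1) / \<delta>)"
    have "(\<Prod>m\<in>L. factor n m) \<le> exp ?E"
      unfolding l_def by (rule prod_near[OF M fin(2)]) (use \<eta> in \<open>auto simp: L_def inj_on_def\<close>)
    moreover have "(\<Prod>m\<in>R. factor n m) \<le> exp ?E"
      unfolding l_def by (rule prod_near[OF M fin(3)]) (use \<eta> in \<open>auto simp: R_def inj_on_def\<close>)
    moreover have "(\<Prod>m\<in>F. factor n m) \<le> exp (real M * (2 + 2 / lam 0) + (4 * lam n + 2) * \<theta>)"
      by (rule prod_far[OF M fin(1)]) (auto simp: F_def)
    ultimately have "(\<Prod>m\<in>F. factor n m) * ((\<Prod>m\<in>L. factor n m) * (\<Prod>m\<in>R. factor n m))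
        \<le> exp (real M * (2 + 2 / lam 0) + (4 * lam n + 2) * \<theta>) * (exp ?E * exp ?E)"
      by (intro mult_mono prod_nonneg mult_nonneg_nonneg factor_nonneg exp_ge_zero)
    also have "\<dots> = exp (c + (4 * \<theta> * (1 + l) + 6 * (\<eta> / \<delta>)) * lam n)"
      unfolding exp_add[symmetric] by (rule arg_cong[where f = exp])
        (simp add: c_def algebra_simps add_divide_distrib)
    also have "\<dots> \<le> exp (c + \<epsilon> * lam n)"
    proof -
      have "12 * (\<eta> / \<delta>) \<le> \<epsilon>" using \<eta>(3) \<delta>_pos by (simp add: divide_le_eq)
      then show ?thesis using \<theta>(2) lam_pos[of n] by (intro exp_mono add_left_mono mult_right_mono) auto
    qed
    finally show ?thesis
      unfolding dec using fin dis by (simp add: prod.union_disjoint exp_add)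
  qed
  then show ?thesis by (intro exI[of _ "exp c"]) auto
qed

lemma coefficient_subexponential:
  assumes \<epsilon>: "\<epsilon> > 0"
  shows "\<exists>K>0. \<forall>N n a. n < N \<longrightarrow>
    cmod (a n) \<le> K * exp (\<epsilon> * lam n) * norm (\<Sum>i<N. a i *\<^sub>C pw (lam i))"
proof -
  obtain C where C: "C > 0" "\<And>n N. (\<Prod>m\<in>{..<N}-{n}. factor n m) \<le> C * exp (\<epsilon> / 2 * lam n)"
    using prod_factor_subexponential[of "\<epsilon> / 2"] \<epsilon> by auto
  \<comment> \<open>Chosen so that \<open>2 * x + 1 \<le> D * (1 + \<epsilon> / 2 * x)\<close> for
    positive \<open>x\<close>: half of \<open>\<epsilon>\<close> absorbs the square root, the other
    half the product.\<close>
  define D where "D = 1 + 4 / \<epsilon>"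
  have D: "D > 0" using \<epsilon> by (simp add: D_def add_pos_pos)
  have "cmod (a n) \<le> D * C * exp (\<epsilon> * lam n) * norm (\<Sum>i<N. a i *\<^sub>C pw (lam i))" if n: "n < N" for n N a
  proof -
    have "1 \<le> 2 * lam n + 1" using lam_pos[of n] by simp
    then have "sqrt (2 * lam n + 1) \<le> 2 * lam n + 1"
      by (intro real_le_lsqrt) (auto simp: power2_eq_square)
    also have "\<dots> \<le> D * (1 + \<epsilon> / 2 * lam n)"
      using \<epsilon> lam_pos[of n] by (simp add: D_def field_simps)
    also have "\<dots> \<le> D * exp (\<epsilon> / 2 * lam n)"
      using D by (intro mult_left_mono exp_ge_add_one_self) auto
    finally have s: "sqrt (2 * lam n + 1) \<le> D * exp (\<epsilon> / 2 * lam n)" .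
    have "lam i > -1/2" for i using lam_pos[of i] by simp
    then have "cmod (a n) \<le> sqrt (2 * lam n + 1) * (\<Prod>i\<in>{..<N}-{n}. factor n i)
        * norm (\<Sum>i<N. a i *\<^sub>C pw (lam i))"
      using n by (intro coefficient_bound) (auto simp: inj_on_def lam_eq_iff)
    also have "\<dots> \<le> (D * exp (\<epsilon> / 2 * lam n)) * (C * exp (\<epsilon> / 2 * lam n)) * norm (\<Sum>i<N. a i *\<^sub>C pw (lam i))"
      using D by (intro mult_right_mono mult_mono s C prod_nonneg factor_nonneg norm_ge_zero) auto
    also have "(D * exp (\<epsilon> / 2 * lam n)) * (C * exp (\<epsilon> / 2 * lam n)) = D * C * exp (\<epsilon> * lam n)"
      by (simp flip: exp_add)
    finally show ?thesis .
  qed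
  then show ?thesis using C D by (intro exI[of _ "D * C"]) auto
qed

end

section \<open>Expansions\<close>

text \<open>One coefficient sequence works for every sufficiently large cutoff, so that several
  elements of the span can be written with a common cutoff and subtracted termwise.\<close>

lemma cspan_range_eventually_sum:
  fixes e :: "nat \<Rightarrow> L2"
  assumes "p \<in> cspan (range e)"
  shows "\<exists>a N. \<forall>M\<ge>N. p = (\<Sum>i<M. a i *\<^sub>C e i)"
  using assms
proof (induction rule: L2.span_induct_alt)
  case base
  show ?case by (intro exI[of _ "\<lambda>_. 0"]) simp
next
  case (step c x y)
  then obtain k a N where k: "x = e k" and a: "\<And>M. M \<ge> N \<Longrightarrow> y = (\<Sum>i<M. a i *\<^sub>C e i)" by blast
  have "c *\<^sub>C x + y = (\<Sum>i<M. (a i + (if i = k then c else 0)) *\<^sub>C e i)" if M: "M \<ge> max N (Suc k)" for M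
  proof -
    have "(\<Sum>i<M. (if i = k then c else 0) *\<^sub>C e i) = (\<Sum>i<M. if i = k then c *\<^sub>C e i else 0)"
      by (intro sum.cong refl) simp
    also have "\<dots> = c *\<^sub>C e k" using M by simp
    finally show ?thesis
      using a[of M] M k by (simp add: L2.scale_left_distrib sum.distrib add.commute)
  qed
  then show ?case
    by (intro exI[of _ "\<lambda>i. a i + (if i = k then c else 0)"] exI[of _ "max N (Suc k)"] allI impI)
qed

lemma norm_suminf_diff_le:
  fixes u v :: "nat \<Rightarrow> L2"
  assumes "u sums x" "v sums y" "\<And>n. norm (u n - v n) \<le> w n" "summable w"
  shows "norm (x - y) \<le> suminf w"
proof (rule LIMSEQ_le_const2)
  show "(\<lambda>N. norm (\<Sum>n<N. u n - v n)) \<longlonglongrightarrow> norm (x - y)"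
    using sums_diff[OF assms(1,2)] unfolding sums_def by (intro tendsto_norm)
  have w: "0 \<le> w n" for n using assms(3)[of n] norm_ge_zero order_trans by blast
  have "norm (\<Sum>n<N. u n - v n) \<le> suminf w" for N
  proof -
    have "norm (\<Sum>n<N. u n - v n) \<le> (\<Sum>n<N. w n)"
      by (intro sum_norm_le assms(3))
    also have "\<dots> \<le> suminf w" by (intro sum_le_suminf assms(4) w) auto
    finally show ?thesis .
  qed
  then show "\<exists>N. \<forall>n\<ge>N. norm (\<Sum>n<n. u n - v n) \<le> suminf w" by blast
qed

section \<open>Compact polydiscs and eigenvectors of normal operators\<close>

text \<open>Tychonoff's theorem; the topology on sequences is the product topology.\<close>

lemma compact_polydisc:
  fixes B :: "nat \<Rightarrow> real"
  shows "compact {b :: nat \<Rightarrow> complex. \<forall>n. cmod (b n) \<le> B n}"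
proof -
  have "compactin (product_topology (\<lambda>_. euclidean) UNIV) (PiE UNIV (\<lambda>n. cball (0::complex) (B n)))"
    unfolding compactin_PiE by simp
  moreover have "PiE UNIV (\<lambda>n. cball (0::complex) (B n)) = {b. \<forall>n. cmod (b n) \<le> B n}"
    by (auto simp: PiE_def Pi_def)
  ultimately show ?thesis by (simp add: euclidean_product_topology)
qed

text \<open>An eigenvector of a normal operator is an eigenvector of the adjoint for the conjugate
  eigenvalue. Moving the operator across the inner product then yields two different multiples of
  the same number.\<close>

lemma eigenvectors_of_normal_orthogonal:
  assumes "normal_operator_on H T" and fg: "f \<in> H" "g \<in> H"
    and ev: "T f = \<mu> *\<^sub>C f" "T g = \<nu> *\<^sub>C g" and ne: "\<mu> \<noteq> \<nu>"
  shows "cinner g f = 0"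
proof -
  obtain S where adj: "is_adjoint_on H T S" and comm: "\<And>f. f \<in> H \<Longrightarrow> T (S f) = S (T f)"
    using assms(1) unfolding normal_operator_on_def by blast
  have S: "S f \<in> H" "S (c *\<^sub>C f) = c *\<^sub>C S f" if "f \<in> H" for c f
    using adj that by (auto simp: is_adjoint_on_def bounded_operator_on_def)
  have adjoint: "cinner (T f) g = cinner f (S g)" if "f \<in> H" "g \<in> H" for f g
    using adj that by (simp add: is_adjoint_on_def)
  define u where "u = S f - cnj \<mu> *\<^sub>C f"
  \<comment> \<open>Commutation enters here:
    \<open>T (S f) = S (T f) = \<mu> *\<^sub>C S f\<close>.\<close>
  have "cinner (S f) (S f) = \<mu> * cinner (S f) f"
    using adjoint[OF S(1)[OF fg(1)] fg(1)] by (simp add: comm[OF fg(1)] ev S(2)[OF fg(1)])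
  moreover have "cinner f (S f) = \<mu> * cinner f f"
    using adjoint[OF fg(1) fg(1)] by (simp add: ev)
  ultimately have "cinner u u = 0"
    by (simp add: u_def cinner_diff_left cinner_diff_right right_diff_distrib)
  then have "S f = cnj \<mu> *\<^sub>C f" by (simp add: cinner_self u_def)
  then have "\<nu> * cinner g f = \<mu> * cinner g f"
    using adjoint[OF fg(2,1)] by (simp add: ev)
  then show ?thesis using ne by simp
qed

lemma power_powr:
  "0 < (x::real) \<Longrightarrow> (x ^ k) powr y = (x powr y) ^ k"
  by (induction k) (simp_all add: powr_mult)

section \<open>Coefficient expansion of functions in the closed span\<close>

context muntz_exponents
begin

abbreviation e :: "nat \<Rightarrow> L2" where "e n \<equiv> pw (lam n)"

lemma muntz_space_eq: "muntz_space lam = closure (cspan (range e))"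
  by (simp add: muntz_space_def pw_def)

lemma closed_muntz_space: "closed (muntz_space lam)"
  by (simp add: muntz_space_eq)

lemma csubspace_muntz_space: "csubspace (muntz_space lam)"
  unfolding muntz_space_eq by (rule csubspace_closure[OF L2.subspace_span])

lemma pw_in_muntz_space: "e n \<in> muntz_space lam"
  unfolding muntz_space_eq by (intro subsetD[OF closure_subset] L2.span_base rangeI)

lemma half_lam: "lam n > -1/2"
  using lam_pos[of n] by linarith

lemma dilation_e: "0 < r \<Longrightarrow> r < 1 \<Longrightarrow> dilation r (e n) = complex_of_real (r powr lam n) *\<^sub>C e n"
  by (rule dilation_pw[OF _ _ half_lam])

lemma norm_e_le: "norm (e n) \<le> 1"
  by (rule norm_pw_le) (use lam_pos[of n] in simp)

lemma summable_exp_lam: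
  assumes "\<epsilon> > 0" shows "summable (\<lambda>n. exp (- \<epsilon> * lam n))"
proof (rule summable_comparison_test'[OF summable_mult[OF summable_inverse, of "1 / \<epsilon>"]])
  fix n
  have "0 < \<epsilon> * lam n" using assms lam_pos[of n] by simp
  moreover have "\<epsilon> * lam n \<le> exp (\<epsilon> * lam n)"
    using exp_ge_add_one_self[of "\<epsilon> * lam n"] by linarith
  ultimately have "1 / exp (\<epsilon> * lam n) \<le> 1 / (\<epsilon> * lam n)" by (intro divide_left_mono) auto
  then show "norm (exp (- \<epsilon> * lam n)) \<le> 1 / \<epsilon> * (1 / lam n)"
    by (simp add: exp_minus field_simps)
qed

text \<open>With \<open>\<epsilon> = - ln r / 2\<close> the power \<open>r powr lam n\<close> equals
  \<open>exp (- 2 * \<epsilon> * lam n)\<close>. Half of this decay compensates coefficient growth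
  of order \<open>exp (\<epsilon> * lam n)\<close>, the other half gives summability.\<close>

lemma summable_exp_powr:
  assumes r: "0 < r" "r < 1" shows "summable (\<lambda>n. exp (- ln r / 2 * lam n) * r powr lam n)"
proof -
  have "exp (- ln r / 2 * lam n) * r powr lam n = exp (- (- ln r / 2) * lam n)" for n
    using r by (simp add: powr_def flip: exp_add)
  moreover have "- ln r / 2 > 0" using r by simp
  ultimately show ?thesis using summable_exp_lam[of "- ln r / 2"] by simp
qed

text \<open>Only the dilates are required to be sums of their series; no convergence is claimed for
  the undamped series of \<open>f\<close> itself.\<close>

definition expands :: "(nat \<Rightarrow> complex) \<Rightarrow> L2 \<Rightarrow> bool" where
  "expands c f \<longleftrightarrow> (\<forall>r. 0 < r \<longrightarrow> r < 1 \<longrightarrow>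
     summable (\<lambda>n. cmod (c n * complex_of_real (r powr lam n))) \<and>
     (\<lambda>n. (c n * complex_of_real (r powr lam n)) *\<^sub>C e n) sums dilation r f)"

text \<open>The coefficient functionals are bounded on the span and extend to its closure by Cauchy
  sequences. \<open>K\<close> is obtained before \<open>f\<close>: this uniformity is what
  compactness needs.\<close>

lemma expansion:
  obtains K :: "real \<Rightarrow> real" where
    "\<And>f. f \<in> muntz_space lam \<Longrightarrow>
      \<exists>c. (\<forall>\<epsilon>>0. \<forall>n. cmod (c n) \<le> K \<epsilon> * exp (\<epsilon> * lam n) * norm f) \<and> expands c f"
proof -
  \<comment> \<open>For nonpositive \<open>\<epsilon>\<close> any positive constant serves as a
    dummy, which makes \<open>K\<close> a total function.\<close>
  have "\<forall>\<epsilon>. \<exists>K>0. \<epsilon> > 0 \<longrightarrow> (\<forall>N n a. n < N \<longrightarrow> cmod (a n) \<le> K * exp (\<epsilon> * lam n) * norm (\<Sum>i<N. a i *\<^sub>C e i))"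
    using coefficient_subexponential zero_less_one by blast
  then obtain K where K0: "\<And>\<epsilon>. K \<epsilon> > 0" and
    K: "\<And>\<epsilon> N n a. \<epsilon> > 0 \<Longrightarrow> n < N \<Longrightarrow> cmod (a n) \<le> K \<epsilon> * exp (\<epsilon> * lam n) * norm (\<Sum>i<N. a i *\<^sub>C e i)"
    by metis
  show ?thesis
  proof (rule that[of K])
    fix f assume "f \<in> muntz_space lam"
    then obtain p where p: "\<And>k. p k \<in> cspan (range e)" "p \<longlonglongrightarrow> f"
      unfolding muntz_space_eq closure_sequential by blast
    then have "\<forall>k. \<exists>a N. \<forall>M\<ge>N. p k = (\<Sum>i<M. a i *\<^sub>C e i)"
      using cspan_range_eventually_sum[of _ e] by blast
    then obtain a N where a: "\<And>k M. M \<ge> N k \<Longrightarrow> p k = (\<Sum>i<M. a k i *\<^sub>C e i)"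
      by metis
    have aK: "cmod (a k n) \<le> K \<epsilon> * exp (\<epsilon> * lam n) * norm (p k)" if "\<epsilon> > 0" for \<epsilon> k n
      using K[OF that, of n "max (N k) (Suc n)" "a k"] a[of k "max (N k) (Suc n)"] by simp
    have diffK: "cmod (a k n - a l n) \<le> K \<epsilon> * exp (\<epsilon> * lam n) * norm (p k - p l)" if "\<epsilon> > 0" for \<epsilon> k l n
    proof -
      define M where "M = max (N k) (max (N l) (Suc n))"
      have "p k - p l = (\<Sum>i<M. (a k i - a l i) *\<^sub>C e i)"
        using a[of k M] a[of l M] by (simp add: M_def L2.scale_left_diff_distrib sum_subtractf)
      then show ?thesis using K[OF that, of n M "\<lambda>i. a k i - a l i"] by (simp add: M_def)
    qed
    have "Cauchy (\<lambda>k. a k n)" for n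
    proof (rule metric_CauchyI)
      fix d :: real assume d: "d > 0"
      \<comment> \<open>As \<open>n\<close> is fixed here, the coefficient bound for a single value
        of \<open>\<epsilon>\<close>, namely 1, suffices.\<close>
      define B where "B = K 1 * exp (1 * lam n)"
      have B: "B > 0" using K0 by (simp add: B_def)
      have "Cauchy p" using p(2) by (auto intro: LIMSEQ_imp_Cauchy)
      then obtain M where "\<And>k l. k \<ge> M \<Longrightarrow> l \<ge> M \<Longrightarrow> dist (p k) (p l) < d / B"
        using metric_CauchyD[of p "d / B"] d B by auto
      then have p_dist: "norm (p k - p l) < d / B" if "k \<ge> M" "l \<ge> M" for k l
        using that by (simp add: dist_norm)
      have "dist (a k n) (a l n) < d" if "k \<ge> M" "l \<ge> M" for k l
      proof -
        have "dist (a k n) (a l n) \<le> B * norm (p k - p l)"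
          using diffK[of 1 k n l] by (simp add: dist_norm B_def)
        also have "\<dots> < B * (d / B)"
          using p_dist[OF that] B by (intro mult_strict_left_mono)
        finally show ?thesis using B by simp
      qed
      then show "\<exists>M. \<forall>k\<ge>M. \<forall>l\<ge>M. dist (a k n) (a l n) < d" by blast
    qed
    then have "\<exists>c. \<forall>n. (\<lambda>k. a k n) \<longlonglongrightarrow> c n"
      unfolding Cauchy_convergent_iff convergent_def by (rule choice[OF allI])
    then obtain c where c: "\<And>n. (\<lambda>k. a k n) \<longlonglongrightarrow> c n" by blast
    have cK: "cmod (c n) \<le> K \<epsilon> * exp (\<epsilon> * lam n) * norm f" if "\<epsilon> > 0" for \<epsilon> n
    proof (rule LIMSEQ_le)
      show "(\<lambda>k. cmod (a k n)) \<longlonglongrightarrow> cmod (c n)"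
        by (rule tendsto_norm[OF c])
      show "(\<lambda>k. K \<epsilon> * exp (\<epsilon> * lam n) * norm (p k)) \<longlonglongrightarrow> K \<epsilon> * exp (\<epsilon> * lam n) * norm f"
        by (intro tendsto_mult_left tendsto_norm p(2))
      show "\<exists>N. \<forall>k\<ge>N. cmod (a k n) \<le> K \<epsilon> * exp (\<epsilon> * lam n) * norm (p k)"
        using aK[OF that] by blast
    qed
    have dK: "cmod (c n - a k n) \<le> K \<epsilon> * exp (\<epsilon> * lam n) * norm (f - p k)" if "\<epsilon> > 0" for \<epsilon> n k
    proof (rule LIMSEQ_le)
      show "(\<lambda>l. cmod (a l n - a k n)) \<longlonglongrightarrow> cmod (c n - a k n)"
        by (intro tendsto_norm tendsto_diff c tendsto_const)
      show "(\<lambda>l. K \<epsilon> * exp (\<epsilon> * lam n) * norm (p l - p k)) \<longlonglongrightarrow> K \<epsilon> * exp (\<epsilon> * lam n) * norm (f - p k)"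
        by (intro tendsto_mult_left tendsto_norm tendsto_diff p(2) tendsto_const)
      show "\<exists>N. \<forall>l\<ge>N. cmod (a l n - a k n) \<le> K \<epsilon> * exp (\<epsilon> * lam n) * norm (p l - p k)"
        using diffK[OF that] by blast
    qed
    have "expands c f"
      unfolding expands_def
    proof (intro allI impI)
      fix r :: real assume r: "0 < r" "r < 1"
      define \<epsilon> where "\<epsilon> = - ln r / 2"
      have \<epsilon>: "\<epsilon> > 0" using r by (simp add: \<epsilon>_def)
      define w where "w n = exp (\<epsilon> * lam n) * r powr lam n" for n
      have w: "summable w" "\<And>n. 0 \<le> w n"
        using summable_exp_powr[OF r] by (simp_all add: w_def[abs_def] \<epsilon>_def)
      let ?R = "\<lambda>n. complex_of_real (r powr lam n)"
      have cr: "cmod (c n * ?R n) \<le> K \<epsilon> * norm f * w n" for n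
      proof -
        have "cmod (c n * ?R n) = cmod (c n) * r powr lam n" by (simp add: norm_mult)
        also have "\<dots> \<le> (K \<epsilon> * exp (\<epsilon> * lam n) * norm f) * r powr lam n"
          by (intro mult_right_mono cK[OF \<epsilon>]) simp
        finally show ?thesis by (simp add: w_def mult_ac)
      qed
      have sc: "summable (\<lambda>n. cmod (c n * ?R n))"
        by (rule summable_comparison_test'[OF summable_mult[OF w(1), of "K \<epsilon> * norm f"]])
           (use cr in simp)
      have "summable (\<lambda>n. (c n * ?R n) *\<^sub>C e n)"
        by (rule summable_pw[OF sc]) (use lam_pos less_imp_le in blast)
      then obtain s where s: "(\<lambda>n. (c n * ?R n) *\<^sub>C e n) sums s" by (auto simp: summable_def)
      \<comment> \<open>The sum \<open>s\<close> is identified with the dilate of \<open>f\<close>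
        by showing that the dilates of \<open>p k\<close> converge to both.\<close>
      have "norm (s - dilation r (p k)) \<le> norm (f - p k) * (K \<epsilon> * suminf w)" for k
      proof -
        \<comment> \<open>The partial sums up to \<open>n\<close> and \<open>Suc n\<close> both
          equal \<open>p k\<close>.\<close>
        have az: "a k n *\<^sub>C e n = 0" if "n \<ge> N k" for n
          using a[of k n] a[of k "Suc n"] that by simp
        have "(\<lambda>n. (a k n * ?R n) *\<^sub>C e n) sums (\<Sum>n<N k. (a k n * ?R n) *\<^sub>C e n)"
        proof (rule sums_finite)
          fix n assume "n \<notin> {..<N k}"
          then have "?R n *\<^sub>C a k n *\<^sub>C e n = 0" by (simp only: az[of n] not_less lessThan_iff L2.scale_zero_right)
          then show "(a k n * ?R n) *\<^sub>C e n = 0" by (simp only: L2.scale_scale mult.commute)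
        qed simp
        moreover have "(\<Sum>n<N k. (a k n * ?R n) *\<^sub>C e n) = dilation r (p k)"
          using a[of k "N k"] by (simp add: dilation_sum dilation_scaleC dilation_e[OF r])
        ultimately have t: "(\<lambda>n. (a k n * ?R n) *\<^sub>C e n) sums dilation r (p k)" by (simp only:)
        have "norm (s - dilation r (p k)) \<le> (\<Sum>n. norm (f - p k) * K \<epsilon> * w n)"
        proof (rule norm_suminf_diff_le[OF s t])
          fix n
          have "norm ((c n * ?R n) *\<^sub>C e n - (a k n * ?R n) *\<^sub>C e n) = cmod (c n - a k n) * r powr lam n * norm (e n)"
            by (simp only: L2.scale_left_diff_distrib[symmetric] left_diff_distrib[symmetric] norm_scaleC norm_mult norm_of_real) simp
          also have "\<dots> \<le> (K \<epsilon> * exp (\<epsilon> * lam n) * norm (f - p k)) * r powr lam n * 1"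
            using K0[of \<epsilon>] by (intro mult_mono dK[OF \<epsilon>] norm_e_le) auto
          finally show "norm ((c n * ?R n) *\<^sub>C e n - (a k n * ?R n) *\<^sub>C e n) \<le> norm (f - p k) * K \<epsilon> * w n"
            by (simp add: w_def mult_ac)
        qed (intro summable_mult w(1))
        then show ?thesis by (simp only: suminf_mult[OF w(1)] mult.assoc[symmetric])
      qed
      moreover have "(\<lambda>k. norm (f - p k) * (K \<epsilon> * suminf w)) \<longlonglongrightarrow> 0"
      proof -
        have "(\<lambda>k. norm (f - p k) * (K \<epsilon> * suminf w)) \<longlonglongrightarrow> norm (f - f) * (K \<epsilon> * suminf w)"
          by (intro tendsto_intros p(2))
        then show ?thesis by simp
      qed
      ultimately have "(\<lambda>k. s - dilation r (p k)) \<longlonglongrightarrow> 0"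
        by (rule Lim_null_comparison[OF always_eventually, OF allI])
      moreover have "(\<lambda>k. s - dilation r (p k)) \<longlonglongrightarrow> s - dilation r f"
        by (intro tendsto_diff tendsto_const bounded_linear.tendsto[OF bounded_linear_dilation[OF r]] p(2))
      ultimately have "s = dilation r f" using LIMSEQ_unique by fastforce
      then show "summable (\<lambda>n. cmod (c n * ?R n)) \<and> (\<lambda>n. (c n * ?R n) *\<^sub>C e n) sums dilation r f"
        using sc s by blast
    qed
    then show "\<exists>c. (\<forall>\<epsilon>>0. \<forall>n. cmod (c n) \<le> K \<epsilon> * exp (\<epsilon> * lam n) * norm f) \<and> expands c f"
      using cK by blast
  qed
qed

lemma expandsE:
  assumes "f \<in> muntz_space lam" obtains c where "expands c f"
  using expansion assms by metis

lemma dilation_muntz_space: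
  assumes r: "0 < r" "r < 1" and f: "f \<in> muntz_space lam"
  shows "dilation r f \<in> muntz_space lam"
proof -
  obtain c where "expands c f" using expandsE[OF f] .
  then have s: "(\<lambda>n. (c n * complex_of_real (r powr lam n)) *\<^sub>C e n) sums dilation r f"
    using r by (simp add: expands_def)
  show ?thesis
    by (rule closed_sequentially[OF closed_muntz_space _ s[unfolded sums_def]])
       (intro L2.subspace_sum csubspace_muntz_space L2.subspace_scale pw_in_muntz_space)
qed

lemma bounded_operator_dilation:
  assumes r: "0 < r" "r < 1"
  shows "bounded_operator_on (muntz_space lam) (dilation r)"
  unfolding bounded_operator_on_def
proof (intro conjI)
  show "\<exists>K. \<forall>f\<in>muntz_space lam. norm (dilation r f) \<le> K * norm f"
    using norm_dilation_le[OF r] by (intro exI[of _ "1 / sqrt r"]) simp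
qed (auto simp: dilation_add dilation_scaleC dilation_muntz_space[OF r])

section \<open>Compactness, normality and synthesis\<close>

text \<open>The damped coefficients of all functions in the unit ball satisfy the summable bound
  \<open>B\<close>, so their dilates are values of \<open>\<Phi>\<close> on the compact polydisc
  \<open>S\<close>.\<close>

lemma compact_dilation:
  assumes r: "0 < r" "r < 1"
  shows "compact (closure (dilation r ` (muntz_space lam \<inter> cball 0 1)))"
proof -
  obtain K :: "real \<Rightarrow> real" where K: "\<And>f. f \<in> muntz_space lam \<Longrightarrow>
      \<exists>c. (\<forall>\<epsilon>>0. \<forall>n. cmod (c n) \<le> K \<epsilon> * exp (\<epsilon> * lam n) * norm f) \<and> expands c f"
    by (rule expansion) blast
  define \<epsilon> where "\<epsilon> = - ln r / 2"
  have \<epsilon>: "\<epsilon> > 0" using r by (simp add: \<epsilon>_def)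
  define B where "B n = \<bar>K \<epsilon>\<bar> * (exp (\<epsilon> * lam n) * r powr lam n)" for n
  have B: "summable B"
    unfolding B_def \<epsilon>_def by (intro summable_mult summable_exp_powr r)
  define S where "S = {b :: nat \<Rightarrow> complex. \<forall>n. cmod (b n) \<le> B n}"
  define \<Phi> where "\<Phi> b = (\<Sum>n. b n *\<^sub>C e n)" for b
  have \<Phi>: "(\<lambda>n. b n *\<^sub>C e n) sums \<Phi> b" if "b \<in> S" for b
    unfolding \<Phi>_def
  proof (rule summable_sums, rule summable_pw)
    show "summable (\<lambda>n. cmod (b n))"
      by (rule summable_comparison_test'[OF B]) (use that in \<open>simp add: S_def\<close>)
  qed (use lam_pos less_imp_le in blast)
  have tail: "norm (\<Phi> b - (\<Sum>n<N. b n *\<^sub>C e n)) \<le> (\<Sum>n. B (n + N))" if b: "b \<in> S" for b N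
  proof -
    have "norm ((\<Phi> b - (\<Sum>n<N. b n *\<^sub>C e n)) - 0) \<le> (\<Sum>n. B (n + N))"
    proof (rule norm_suminf_diff_le[OF sums_split_initial_segment[OF \<Phi>[OF b]] sums_zero])
      show "norm (b (n + N) *\<^sub>C e (n + N) - 0) \<le> B (n + N)" for n
        using b norm_e_le[of "n + N"] mult_left_le[of "norm (e (n + N))" "cmod (b (n + N))"]
        by (fastforce simp: S_def intro: order_trans)
    qed (rule summable_ignore_initial_segment[OF B])
    then show ?thesis by simp
  qed
  \<comment> \<open>Each partial sum depends on finitely many coordinates, and the tails of
    \<open>B\<close> make the convergence uniform on \<open>S\<close>.\<close>
  have "continuous_on S \<Phi>"
  proof (rule uniform_limit_theorem)
    show "\<forall>\<^sub>F N in sequentially. continuous_on S (\<lambda>b. \<Sum>n<N. b n *\<^sub>C e n)"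
      by (intro always_eventually allI continuous_on_sum scaleC.continuous_on continuous_on_const
          continuous_on_subset[OF continuous_on_product_coordinates]) auto
    show "uniform_limit S (\<lambda>N b. \<Sum>n<N. b n *\<^sub>C e n) \<Phi> sequentially"
    proof (rule uniform_limitI)
      fix d :: real assume "d > 0"
      then have "\<forall>\<^sub>F N in sequentially. (\<Sum>n. B (n + N)) < d"
        by (intro order_tendstoD(2)[OF suminf_exist_split2[OF B]])
      then show "\<forall>\<^sub>F N in sequentially. \<forall>b\<in>S. dist (\<Sum>n<N. b n *\<^sub>C e n) (\<Phi> b) < d"
      proof eventually_elim
        case (elim N)
        show ?case
          unfolding dist_norm norm_minus_commute[of "sum _ _"] using le_less_trans[OF tail elim] by blast
      qed
    qed
  qed simp
  then have cpt: "compact (\<Phi> ` S)"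
    using compact_polydisc[of B] by (simp add: S_def compact_continuous_image)
  have "dilation r ` (muntz_space lam \<inter> cball 0 1) \<subseteq> \<Phi> ` S"
  proof
    fix g assume "g \<in> dilation r ` (muntz_space lam \<inter> cball 0 1)"
    then obtain f where f: "f \<in> muntz_space lam" "norm f \<le> 1" "g = dilation r f" by auto
    obtain c where c: "\<And>n. cmod (c n) \<le> K \<epsilon> * exp (\<epsilon> * lam n) * norm f" "expands c f"
      using K[OF f(1)] \<epsilon> by blast
    define b where "b n = c n * complex_of_real (r powr lam n)" for n
    have "b \<in> S"
      unfolding S_def
    proof (intro CollectI allI)
      fix n
      have "cmod (b n) = cmod (c n) * r powr lam n" by (simp add: b_def norm_mult)
      also have "\<dots> \<le> (K \<epsilon> * exp (\<epsilon> * lam n) * norm f) * r powr lam n"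
        by (intro mult_right_mono c(1)) simp
      also have "\<dots> = (exp (\<epsilon> * lam n) * r powr lam n) * (K \<epsilon> * norm f)" by (simp add: mult_ac)
      also have "\<dots> \<le> (exp (\<epsilon> * lam n) * r powr lam n) * (\<bar>K \<epsilon>\<bar> * 1)"
        using f(2) by (intro mult_left_mono order_trans[OF mult_right_mono[OF abs_ge_self]] mult_left_mono) auto
      finally show "cmod (b n) \<le> B n" by (simp add: B_def mult_ac)
    qed
    moreover have "(\<lambda>n. b n *\<^sub>C e n) sums g"
      using c(2) r f(3) by (simp add: expands_def b_def)
    ultimately have "\<Phi> b = g" using \<Phi> sums_unique2 by blast
    then show "g \<in> \<Phi> ` S" using \<open>b \<in> S\<close> by blast
  qed
  then have "closure (dilation r ` (muntz_space lam \<inter> cball 0 1)) \<subseteq> \<Phi> ` S"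
    by (rule closure_minimal) (rule compact_imp_closed[OF cpt])
  then show ?thesis
    using cpt by (metis closed_closure compact_Int_closed inf.absorb_iff2)
qed

lemma not_normal_dilation:
  assumes r: "0 < r" "r < 1"
  shows "\<not> normal_operator_on (muntz_space lam) (dilation r)"
proof
  assume n: "normal_operator_on (muntz_space lam) (dilation r)"
  have "r powr lam 0 \<noteq> r powr lam 1" using r lam_eq_iff[of 0 1] by (simp add: powr_inj)
  then have "cinner (e 1) (e 0) = 0"
    by (intro eigenvectors_of_normal_orthogonal[OF n pw_in_muntz_space pw_in_muntz_space
          dilation_e[OF r] dilation_e[OF r]]) simp
  then have "1 / (lam 1 + lam 0 + 1) = 0"
    using cinner_pw[OF half_lam half_lam, of 1 0] by (simp only: of_real_eq_0_iff)
  then show False using lam_pos[of 0] lam_pos[of 1] by simp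
qed

section \<open>Recovering functions from dilates; invariant subspaces\<close>

text \<open>The dilations converge on the dense span and are eventually bounded by a common
  constant, hence converge on the closure.\<close>

lemma dilation_tendsto_ident:
  assumes r: "\<And>j. 0 < r j" "\<And>j. r j < 1" "r \<longlonglongrightarrow> 1" and f: "f \<in> muntz_space lam"
  shows "(\<lambda>j. dilation (r j) f) \<longlonglongrightarrow> f"
proof -
  define G where "G = {f. (\<lambda>j. dilation (r j) f) \<longlonglongrightarrow> f}"
  have "csubspace G"
    unfolding L2.subspace_def G_def
    by (auto simp: dilation_add dilation_scaleC intro: tendsto_add scaleC.tendsto)
  moreover have "range e \<subseteq> G"
  proof (clarsimp simp: G_def)
    fix n
    have "(\<lambda>j. complex_of_real (r j powr lam n) *\<^sub>C e n) \<longlonglongrightarrow> complex_of_real (1 powr lam n) *\<^sub>C e n"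
      by (intro scaleC.tendsto tendsto_const tendsto_of_real tendsto_powr r(3)) simp
    then show "(\<lambda>j. dilation (r j) (e n)) \<longlonglongrightarrow> e n"
      by (simp add: dilation_e[OF r(1,2)])
  qed
  ultimately have sp: "cspan (range e) \<subseteq> G" by (intro L2.span_minimal)
  show ?thesis
  proof (rule tendstoI)
    fix d :: real assume d: "d > 0"
    obtain p where p: "p \<in> cspan (range e)" "norm (f - p) < d / 4"
      using f d closure_approachable[of f "cspan (range e)"] unfolding muntz_space_eq
      by (metis dist_norm dist_commute zero_less_divide_iff zero_less_numeral)
    have "(\<lambda>j. dilation (r j) p) \<longlonglongrightarrow> p" using p(1) sp by (auto simp: G_def)
    then have "\<forall>\<^sub>F j in sequentially. dist (dilation (r j) p) p < d / 4"
      using d by (intro tendstoD) auto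
    \<comment> \<open>This bounds the dilation by 2, so the three error terms are below d/2, d/4 and
      d/4.\<close>
    moreover have "\<forall>\<^sub>F j in sequentially. 1 / 4 < r j"
      by (rule order_tendstoD(1)[OF r(3)]) simp
    ultimately show "\<forall>\<^sub>F j in sequentially. dist (dilation (r j) f) f < d"
    proof eventually_elim
      case (elim j)
      have "sqrt (1 / 4) \<le> sqrt (r j)" using elim(2) by (intro real_sqrt_le_mono) simp
      then have s: "1 / 2 \<le> sqrt (r j)" by (simp add: real_sqrt_divide)
      have "norm (dilation (r j) (f - p)) \<le> norm (f - p) / sqrt (r j)"
        by (rule norm_dilation_le[OF r(1,2)])
      also have "\<dots> \<le> norm (f - p) / (1 / 2)"
        using s r(1)[of j] by (intro divide_left_mono mult_pos_pos) auto
      finally have "norm (dilation (r j) (f - p)) \<le> 2 * norm (f - p)" by simp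
      moreover have "dilation (r j) f - f = dilation (r j) (f - p) + (dilation (r j) p - p) - (f - p)"
        by (simp add: dilation_diff)
      then have "norm (dilation (r j) f - f)
          \<le> norm (dilation (r j) (f - p)) + norm (dilation (r j) p - p) + norm (f - p)"
        by (metis norm_triangle_ineq norm_triangle_ineq4 add_right_mono order_trans)
      ultimately show ?case using elim(1) p(2) by (simp add: dist_norm)
    qed
  qed
qed

lemma pw_in_invariant_subspace:
  assumes \<rho>: "0 < \<rho>" "\<rho> < 1"
    and A: "csubspace A" "closed A" "dilation \<rho> ` A \<subseteq> A"
    and f: "f \<in> A" "expands c f" and c: "c n \<noteq> 0"
  shows "e n \<in> A"
  using c
proof (induction n rule: less_induct)
  case (less n)
  \<comment> \<open>Removing the lower terms, which lie in \<open>A\<close> by induction or vanish,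
    makes \<open>e n\<close> the term that decays most slowly under iteration.\<close>
  define g where "g = f - (\<Sum>m<n. c m *\<^sub>C e m)"
  have "c m *\<^sub>C e m \<in> A" if "m < n" for m
    using less.IH[OF that] A(1) by (cases "c m = 0") (auto intro: L2.subspace_scale L2.subspace_0)
  then have g: "g \<in> A"
    unfolding g_def by (intro L2.subspace_diff A f L2.subspace_sum) auto
  \<comment> \<open>Exponents start at 1, since \<open>dilation 1\<close> has the dummy value
    0.\<close>
  have \<rho>k: "0 < \<rho> ^ Suc k" "\<rho> ^ Suc k < 1" for k
    using \<rho> power_Suc_less_one[OF \<rho>] by simp_all
  have iter: "dilation (\<rho> ^ Suc k) g \<in> A" for k
  proof (induction k)
    case (Suc k)
    then show ?case
      using A(3) dilation_dilation[OF \<rho> \<rho>k[of k], of g] by auto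
  qed (use g A(3) in auto)
  let ?R = "\<lambda>m. \<rho> powr lam m"
  define W where "W = (\<Sum>i. cmod (c i * complex_of_real (?R i)))"
  have sW: "summable (\<lambda>i. cmod (c i * complex_of_real (?R i)))"
    using f(2) \<rho> by (simp add: expands_def)
  define \<alpha> \<beta> where "\<alpha> = ?R n" and "\<beta> = ?R (Suc n)"
  have \<alpha>\<beta>: "0 < \<alpha>" "0 < \<beta>" "\<beta> < \<alpha>"
    using \<rho> strict_mono_lam[THEN strict_monoD, of n "Suc n"]
    by (simp_all add: \<alpha>_def \<beta>_def powr_less_mono')
  \<comment> \<open>Of the \<open>Suc k\<close> powers of \<open>\<rho> powr lam i\<close>, one
    stays with the coefficient to keep the sum below \<open>W\<close>; the other \<open>k\<close>
    are at most \<open>\<beta>\<close> each.\<close>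
  have "norm (dilation (\<rho> ^ Suc k) g - (c n * complex_of_real (\<alpha> ^ Suc k)) *\<^sub>C e n) \<le> \<beta> ^ k * W" for k
  proof -
    let ?F = "\<lambda>m. (c m * complex_of_real ((\<rho> ^ Suc k) powr lam m)) *\<^sub>C e m"
    have F: "?F sums dilation (\<rho> ^ Suc k) f" using f(2) \<rho>k by (simp only: expands_def)
    have gF: "dilation (\<rho> ^ Suc k) g - (c n * complex_of_real (\<alpha> ^ Suc k)) *\<^sub>C e n
        = dilation (\<rho> ^ Suc k) f - (\<Sum>m<Suc n. ?F m)"
      using \<rho> by (simp add: g_def dilation_diff dilation_sum dilation_scaleC dilation_e[OF \<rho>k] power_powr \<alpha>_def
          del: power_Suc)
    have "norm ((dilation (\<rho> ^ Suc k) f - (\<Sum>m<Suc n. ?F m)) - 0)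
        \<le> (\<Sum>i. \<beta> ^ k * cmod (c (i + Suc n) * complex_of_real (?R (i + Suc n))))"
    proof (rule norm_suminf_diff_le[OF sums_split_initial_segment[OF F] sums_zero])
      fix i
      let ?m = "i + Suc n"
      have "?R ?m \<le> \<beta>"
        unfolding \<beta>_def using \<rho> strict_mono_less_eq[OF strict_mono_lam] by (intro powr_mono') auto
      then have "?R ?m ^ k \<le> \<beta> ^ k" by (intro power_mono) auto
      have "norm (?F ?m - 0) = cmod (c ?m) * ?R ?m * ?R ?m ^ k * norm (e ?m)"
        using \<rho> by (simp add: norm_mult norm_power power_powr[of \<rho> "Suc k", simplified])
      also have "\<dots> \<le> cmod (c ?m) * ?R ?m * \<beta> ^ k * 1"
        by (intro mult_mono norm_e_le mult_left_mono \<open>?R ?m ^ k \<le> \<beta> ^ k\<close>) (use \<alpha>\<beta> in auto)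
      finally show "norm (?F ?m - 0) \<le> \<beta> ^ k * cmod (c ?m * complex_of_real (?R ?m))"
        by (simp add: norm_mult mult_ac)
    qed (intro summable_mult summable_ignore_initial_segment[OF sW])
    also have "\<dots> = \<beta> ^ k * (\<Sum>i. cmod (c (i + Suc n) * complex_of_real (?R (i + Suc n))))"
      by (intro suminf_mult summable_ignore_initial_segment[OF sW])
    also have "\<dots> \<le> \<beta> ^ k * W"
    proof (intro mult_left_mono)
      show "(\<Sum>i. cmod (c (i + Suc n) * complex_of_real (?R (i + Suc n)))) \<le> W"
        unfolding W_def using suminf_minus_initial_segment[OF sW, of "Suc n"]
          sum_nonneg[of "{..<Suc n}" "\<lambda>i. cmod (c i * complex_of_real (?R i))"]
        by (simp del: sum.lessThan_Suc)
    qed (use \<alpha>\<beta> in simp)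
    finally show ?thesis unfolding gF by simp
  qed
  note est = this
  \<comment> \<open>Dividing by the power \<open>k\<close> rather than \<open>Suc k\<close> leaves
    one factor \<open>\<alpha>\<close> in the limit.\<close>
  define u where "u k = complex_of_real (1 / \<alpha> ^ k) *\<^sub>C dilation (\<rho> ^ Suc k) g" for k
  have "norm (u k - (c n * complex_of_real \<alpha>) *\<^sub>C e n) \<le> (\<beta> / \<alpha>) ^ k * W" for k
  proof -
    have "u k - (c n * complex_of_real \<alpha>) *\<^sub>C e n
        = complex_of_real (1 / \<alpha> ^ k) *\<^sub>C (dilation (\<rho> ^ Suc k) g - (c n * complex_of_real (\<alpha> ^ Suc k)) *\<^sub>C e n)"
      using \<alpha>\<beta> by (simp add: u_def L2.scale_right_diff_distrib)
    then have "norm (u k - (c n * complex_of_real \<alpha>) *\<^sub>C e n)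
        = 1 / \<alpha> ^ k * norm (dilation (\<rho> ^ Suc k) g - (c n * complex_of_real (\<alpha> ^ Suc k)) *\<^sub>C e n)"
      using \<alpha>\<beta> by (simp only: norm_scaleC norm_of_real) simp
    also have "\<dots> \<le> 1 / \<alpha> ^ k * (\<beta> ^ k * W)"
      using \<alpha>\<beta> by (intro mult_left_mono est) auto
    finally show ?thesis by (simp add: power_divide)
  qed
  moreover have "(\<lambda>k. (\<beta> / \<alpha>) ^ k * W) \<longlonglongrightarrow> 0"
    using \<alpha>\<beta> by (intro tendsto_mult_left_zero LIMSEQ_realpow_zero) auto
  ultimately have "(\<lambda>k. u k - (c n * complex_of_real \<alpha>) *\<^sub>C e n) \<longlonglongrightarrow> 0"
    by (rule Lim_null_comparison[OF always_eventually, OF allI])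
  then have "u \<longlonglongrightarrow> (c n * complex_of_real \<alpha>) *\<^sub>C e n" by (rule LIM_zero_cancel)
  moreover have "u k \<in> A" for k
    unfolding u_def by (intro L2.subspace_scale A iter)
  ultimately have "(c n * complex_of_real \<alpha>) *\<^sub>C e n \<in> A"
    using closed_sequentially[OF A(2)] by blast
  then have "inverse (c n * complex_of_real \<alpha>) *\<^sub>C (c n * complex_of_real \<alpha>) *\<^sub>C e n \<in> A"
    by (rule L2.subspace_scale[OF A(1)])
  moreover have nz: "c n * complex_of_real \<alpha> \<noteq> 0" using less.prems \<alpha>\<beta> by simp
  ultimately show ?case by (simp only: L2.scale_scale left_inverse[OF nz] L2.scale_one)
qed

lemma e_eigenvector:
  assumes "0 < r" "r < 1" shows "e n \<in> eigenvectors_on (muntz_space lam) (dilation r)"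
  using assms pw_in_muntz_space dilation_e pw_nonzero[OF half_lam] by (auto simp: eigenvectors_on_def)

lemma synthesis_dilation:
  assumes \<rho>: "0 < \<rho>" "\<rho> < 1"
  shows "admits_spectral_synthesis_on (muntz_space lam) (dilation \<rho>)"
  unfolding admits_spectral_synthesis_on_def
proof (intro conjI allI impI)
  show "bounded_operator_on (muntz_space lam) (dilation \<rho>)"
    by (rule bounded_operator_dilation[OF \<rho>])
  show "\<exists>E\<subseteq>eigenvectors_on (muntz_space lam) (dilation \<rho>). complete_in E (muntz_space lam)"
    using e_eigenvector[OF \<rho>] by (intro exI[of _ "range e"]) (auto simp: complete_in_def muntz_space_eq)
next
  fix A assume "invariant_subspace_on (muntz_space lam) (dilation \<rho>) A"
  then have A: "csubspace A" "closed A" "A \<subseteq> muntz_space lam" "dilation \<rho> ` A \<subseteq> A"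
    by (auto simp: invariant_subspace_on_def)
  let ?E = "eigenvectors_on (muntz_space lam) (dilation \<rho>) \<inter> A"
  have "f \<in> closure (cspan ?E)" if f: "f \<in> A" for f
  proof -
    obtain c where c: "expands c f" using expandsE f A(3) by blast
    \<comment> \<open>Either the coefficient vanishes or \<open>e n\<close> is an eigenvector in
      \<open>A\<close>; thus invariance under the single dilation by \<open>\<rho>\<close> controls
      the dilates by every \<open>r j\<close>.\<close>
    have e: "(c n * z) *\<^sub>C e n \<in> cspan ?E" for n z
      using pw_in_invariant_subspace[OF \<rho> A(1,2,4) f c, of n] e_eigenvector[OF \<rho>, of n]
      by (cases "c n = 0") (auto intro: L2.span_zero L2.span_scale L2.span_base)
    define r where "r j = real (Suc j) / real (Suc (Suc j))" for j
    have r: "0 < r j" "r j < 1" for j by (simp_all add: r_def)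
    have "dilation (r j) f \<in> closure (cspan ?E)" for j
    proof -
      have "(\<lambda>n. (c n * complex_of_real (r j powr lam n)) *\<^sub>C e n) sums dilation (r j) f"
        using c r by (simp only: expands_def)
      then have s: "(\<lambda>N. \<Sum>n<N. (c n * complex_of_real (r j powr lam n)) *\<^sub>C e n) \<longlonglongrightarrow> dilation (r j) f"
        by (simp only: sums_def)
      show ?thesis
        by (rule closed_sequentially[OF closed_closure _ s])
           (intro subsetD[OF closure_subset] L2.span_sum e)
    qed
    moreover have "r \<longlonglongrightarrow> 1"
      unfolding r_def using LIMSEQ_Suc[OF LIMSEQ_n_over_Suc_n[where 'a = real]] by simp
    then have "(\<lambda>j. dilation (r j) f) \<longlonglongrightarrow> f"
      by (rule dilation_tendsto_ident[OF r]) (use f A(3) in blast)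
    ultimately show ?thesis by (rule closed_sequentially[OF closed_closure])
  qed
  moreover have "closure (cspan ?E) \<subseteq> A" by (rule closure_cspan_minimal[OF Int_lower2 A(1,2)])
  ultimately show "complete_in ?E A" by (auto simp: complete_in_def)
qed

end

theorem corollary1p1:
  fixes lam :: "nat \<Rightarrow> real" and \<rho> :: real
  assumes "strict_mono lam" and "\<And>n. 0 < lam n"
    and "summable (\<lambda>n. 1 / lam n)"
    and "0 < (INF n. lam (Suc n) - lam n)"
    and "0 < \<rho>" and "\<rho> < 1"
  shows "compact_operator_on (muntz_space lam) (dilation \<rho>)
    \<and> \<not> normal_operator_on (muntz_space lam) (dilation \<rho>)
    \<and> admits_spectral_synthesis_on (muntz_space lam) (dilation \<rho>)"
proof -
  \<comment> \<open>An infimum of reals is known to be a lower bound only for sets bounded below;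
    monotonicity supplies the bound 0.\<close>
  have "bdd_below (range (\<lambda>n. lam (Suc n) - lam n))"
    by (rule bdd_belowI2[of _ 0]) (use strict_monoD[OF assms(1)] in \<open>simp add: less_imp_le\<close>)
  then interpret muntz_exponents lam "INF n. lam (Suc n) - lam n"
    using assms(2-4) by unfold_locales (auto intro: cINF_lower)
  show ?thesis
    using compact_dilation bounded_operator_dilation not_normal_dilation synthesis_dilation assms(5,6)
    by (simp add: compact_operator_on_def)
qed

end
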